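(* Let $q\ge5$ be a prime power with $\operatorname{char}\mathbb F_q\notin\{2,3\}$, let $R\in\mathbb F_q^\times$, and let $(P_{\mathrm{tc}},\mathcal S_{\mathrm{tc}})$ be the system constructed in the context. Put $N=|P_{\mathrm{tc}}|$ and $\Sigma=\sigma(P_{\mathrm{tc}},\mathcal S_{\mathrm{tc}})$. Then: (1) Every sphere has the prescribed radius $R\ne0$, the lifted parameters $\Phi(S_t)$ are pairwise distinct, and no affine line contains three of them. Hence no coaxal pencil contains three members of $\mathcal S_{\mathrm{tc}}$. (2) One has $$N=\frac{(q-1)^2(q-2)}6,\qquad p_A\in S_t\iff t\in A.$$ Consequently every point has degree three and $$I(P_{\mathrm{tc}},\mathcal S_{\mathrm{tc}})=3N,\qquad\Sigma=2N,\qquad K_q=\frac{2\sqrt N}{q^{3/2}}\longrightarrow\sqrt{\frac23}\quad(q\to\infty),$$ where $K_q$ is defined by $\Sigma=K_qq\sqrt{|P_{\mathrm{tc}}||\mathcal S_{\mathrm{tc}}|}$. In particular, $K_q^2q^2|\mathcal S_{\mathrm{tc}}|=4|P_{\mathrm{tc}}|$. (3) For distinct $a,b\in\mathbb F_q$, $$q-3\le|P_{\mathrm{tc}}\cap S_a\cap S_b|\le q-2.$$ The system lies in the moderate window $\frac{4|P_{\mathrm{tc}}|}{K_q^2q^2}\le|\mathcal S_{\mathrm{tc}}|\le C_1K_qq$ with $C_1=2$, and its rich-pair graph is complete: every two distinct $S,S'\in\mathcal S_{\mathrm{tc}}$ satisfy $|P_{\mathrm{tc}}\cap S\cap S'|\ge\frac{K_qq}{4C_1}$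 with $C_1=2$. (4) Every $B\subseteq P_{\mathrm{tc}}$ satisfies $\sigma(B,\mathcal S_{\mathrm{tc}})=2|B|$, and every distinct sphere pair obeys $$\frac{\sigma(P_{\mathrm{tc}}\cap S_a\cap S_b,\mathcal S_{\mathrm{tc}})}\Sigma\le\frac6{(q-1)^2}.$$ (5) The incidence system is $\mathcal D_{3,0}$ (via $p_A\leftrightarrow A$, $S_t\leftrightarrow t$). Hence, for every $0<\tau\le1$, whenever $q\ge96/\tau$, it has no $(\tau,\varepsilon)$-centered block decomposition with $\varepsilon\le\tau^2/144$. Moreover, every nondegenerate ternary quadratic form over $\mathbb F_q$, in characteristic different from two and three, admits an incidence-isomorphic example whose spheres have one fixed nonzero radius.
   Context: For a nondegenerate quadratic form $Q$ on $\mathbb F_q^3$, $S_Q(c,r)=\{x:Q(x-c)=r\}$ and the lift is $\Phi(S_Q(c,r))=(2c,r-Q(c))\in\mathbb F_q^4$; a coaxal pencil is the family of $q$ spheres whose lifts form an affine line. $I(P,\mathcal S)=|\{(p,S)\in P\times\mathcal S:p\in S\}|$, $\sigma(P,\mathcal S)=I(P,\mathcal S)-|P||\mathcal S|/q$; degree of a point means the number of spheres of the family containing it. Construction. Let $Q_0(x,y,z)=xy+z^2$ on $\mathbb F_q^3$, $c_t=(0,t^3,t)$, $S_t=S_{Q_0}(c_t,R)$ for $t\in\mathbb F_q$, and $\mathcal S_{\mathrm{tc}}=\{S_t:t\in\mathbb F_q\}$. The map $$\Psi(x,y,z)(T)=T^3-\frac1xT^2+\frac{2z}xT-\frac{xy+z^2-R}x$$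 is a bijection from $\{(x,y,z)\in\mathbb F_q^3:x\ne0\}$ onto the monic cubics $T^3-s_1T^2+s_2T-s_3$ with $s_1\ne0$. Let $\mathfrak T=\{A\subseteq\mathbb F_q:|A|=3,\ \sum_{a\in A}a\ne0\}$; for $A\in\mathfrak T$ let $p_A$ be the point with $\Psi(p_A)=\prod_{a\in A}(T-a)$, and put $P_{\mathrm{tc}}=\{p_A:A\in\mathfrak T\}$. $\mathcal D_{3,0}$ is the bipartite incidence system with object set $\mathbb F_q$, point set $\{A\subseteq\mathbb F_q:|A|=3,\ -\sum_{a\in A}a\ne0\}$, and $A$ incident to $t$ iff $t\in A$. With $\Sigma=\sigma(P,\mathcal S)>0$, $0<\tau\le1$, $\varepsilon\ge0$, a $(\tau,\varepsilon)$-centered block decomposition of $(P,\mathcal S)$ consists of an integer $m\ge2$ and partitions $\mathcal S=\mathcal S_1\sqcup\cdots\sqcup\mathcal S_m$, $P=A_1\sqcup\cdots\sqcup A_m\sqcup R'$ such that $\sigma(A_i,\mathcal S_i)\ge\tau\Sigma$ for all $i$, $\sigma(R',\mathcal S)\le\varepsilon\Sigma$, and $\sum_{i\ne j}\max\{\sigma(A_i,\mathcal S_j),0\}\le\varepsilon\Sigma$. *)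

theory Defs
  imports "HOL-Analysis.Analysis" "HOL-Computational_Algebra.Polynomial"
begin

section \<open>Quadratic forms, spheres and pencils\<close>

definition quadratic_form :: "('a::field ^ 'n \<Rightarrow> 'a) \<Rightarrow> bool" where
  "quadratic_form Q \<longleftrightarrow> (\<exists>M :: 'a ^ 'n ^ 'n. \<forall>x. Q x = (\<Sum>i\<in>UNIV. \<Sum>j\<in>UNIV. M $ i $ j * x $ i * x $ j))"

definition polar_form :: "('a::field ^ 'n \<Rightarrow> 'a) \<Rightarrow> 'a ^ 'n \<Rightarrow> 'a ^ 'n \<Rightarrow> 'a" where
  "polar_form Q x y = Q (x + y) - Q x - Q y"

text \<open>Only used away from characteristic two, where all usual notions of nondegeneracy agree.\<close>
definition nondegenerate :: "('a::field ^ 'n \<Rightarrow> 'a) \<Rightarrow> bool" where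
  "nondegenerate Q \<longleftrightarrow> (\<forall>x. (\<forall>y. polar_form Q x y = 0) \<longrightarrow> x = 0)"

definition qsphere :: "('a::field ^ 3 \<Rightarrow> 'a) \<Rightarrow> 'a ^ 3 \<Rightarrow> 'a \<Rightarrow> ('a ^ 3) set" where
  "qsphere Q c r = {x. Q (x - c) = r}"

text \<open>The lift is written as a function of the parameters (centre and radius) of the sphere.\<close>
definition sphere_lift :: "('a::field ^ 3 \<Rightarrow> 'a) \<Rightarrow> 'a ^ 3 \<Rightarrow> 'a \<Rightarrow> 'a ^ 4" where
  "sphere_lift Q c r = vector [2 * c $ 1, 2 * c $ 2, 2 * c $ 3, r - Q c]"

definition affine_line :: "('a::field ^ 'n) set \<Rightarrow> bool" where
  "affine_line L \<longleftrightarrow> (\<exists>u v. v \<noteq> 0 \<and> L = {u + s *s v | s. True})"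

text \<open>In characteristic other than two every point of \<open>'a ^ 4\<close> is the lift of exactly one pair
  \<open>(c, r)\<close>, so a line of lifts with its \<open>CARD('a)\<close> points gives one sphere for each of them.\<close>
definition coaxal_pencil :: "('a::field ^ 3 \<Rightarrow> 'a) \<Rightarrow> ('a ^ 3) set set \<Rightarrow> bool" where
  "coaxal_pencil Q C \<longleftrightarrow>
     (\<exists>L. affine_line L \<and> C = {qsphere Q c r | c r. sphere_lift Q c r \<in> L})"

section \<open>Incidences and discrepancy\<close>

definition incidences :: "'p set \<Rightarrow> 'p set set \<Rightarrow> nat" where
  "incidences P S = card {(p, s). p \<in> P \<and> s \<in> S \<and> p \<in> s}"

definition discrepancy :: "('a::{field,finite} ^ 3) set \<Rightarrow> ('a ^ 3) set set \<Rightarrow> real" where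
  "discrepancy P S = real (incidences P S) - real (card P) * real (card S) / real CARD('a)"

text \<open>The conditions \<open>discrepancy P S > 0\<close>, \<open>0 < \<tau> \<le> 1\<close> and \<open>\<epsilon> \<ge> 0\<close> under which the notion
  is used are not part of the definition. The sets \<open>A i\<close>, \<open>T i\<close> and \<open>R'\<close> may be empty here,
  but \<open>discrepancy (A i) (T i) > 0\<close> makes the blocks nonempty.\<close>
definition centered_block_decomposition ::
  "real \<Rightarrow> real \<Rightarrow> ('a::{field,finite} ^ 3) set \<Rightarrow> ('a ^ 3) set set \<Rightarrow>
   nat \<Rightarrow> (nat \<Rightarrow> ('a ^ 3) set) \<Rightarrow> ('a ^ 3) set \<Rightarrow> (nat \<Rightarrow> ('a ^ 3) set set) \<Rightarrow> bool" where
  "centered_block_decomposition \<tau> \<epsilon> P S m A R' T \<longleftrightarrow>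
     m \<ge> 2 \<and>
     S = (\<Union>i\<in>{1..m}. T i) \<and> disjoint_family_on T {1..m} \<and>
     P = (\<Union>i\<in>{1..m}. A i) \<union> R' \<and> disjoint_family_on A {1..m} \<and>
     (\<Union>i\<in>{1..m}. A i) \<inter> R' = {} \<and>
     (\<forall>i\<in>{1..m}. discrepancy (A i) (T i) \<ge> \<tau> * discrepancy P S) \<and>
     discrepancy R' S \<le> \<epsilon> * discrepancy P S \<and>
     (\<Sum>(i, j)\<in>{(i, j). i \<in> {1..m} \<and> j \<in> {1..m} \<and> i \<noteq> j}. max (discrepancy (A i) (T j)) 0)
       \<le> \<epsilon> * discrepancy P S"

text \<open>A bipartite incidence system: objects, points, and the relation ``point on object''.\<close>
type_synonym ('s, 'p) inc_system = "'s set \<times> 'p set \<times> ('p \<Rightarrow> 's \<Rightarrow> bool)"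

definition sphere_system :: "'p set \<Rightarrow> 'p set set \<Rightarrow> ('p set, 'p) inc_system" where
  "sphere_system P S = (S, P, \<lambda>p s. p \<in> s)"

definition inc_iso ::
  "('p \<Rightarrow> 'p2) \<Rightarrow> ('s \<Rightarrow> 's2) \<Rightarrow> ('s, 'p) inc_system \<Rightarrow> ('s2, 'p2) inc_system \<Rightarrow> bool" where
  "inc_iso f g X Y \<longleftrightarrow>
     (case X of (S, P, I) \<Rightarrow> case Y of (S', P', I') \<Rightarrow>
        bij_betw f P P' \<and> bij_betw g S S' \<and> (\<forall>p\<in>P. \<forall>s\<in>S. I p s \<longleftrightarrow> I' (f p) (g s)))"

definition D30 :: "('a::{field,finite}, 'a set) inc_system" where
  "D30 = (UNIV, {A. card A = 3 \<and> - (\<Sum>a\<in>A. a) \<noteq> 0}, \<lambda>A t. t \<in> A)"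

section \<open>The twisted cubic construction\<close>

definition Q0 :: "'a::field ^ 3 \<Rightarrow> 'a" where
  "Q0 v = v $ 1 * v $ 2 + (v $ 3)\<^sup>2"

definition tc_center :: "'a::field \<Rightarrow> 'a ^ 3" where
  "tc_center t = vector [0, t ^ 3, t]"

definition tc_sphere :: "'a::field \<Rightarrow> 'a \<Rightarrow> ('a ^ 3) set" where
  "tc_sphere R t = qsphere Q0 (tc_center t) R"

definition S_tc :: "'a::field \<Rightarrow> ('a ^ 3) set set" where
  "S_tc R = {tc_sphere R t | t. True}"

definition Psi :: "'a::field \<Rightarrow> 'a ^ 3 \<Rightarrow> 'a poly" where
  "Psi R v = (let x = v $ 1; y = v $ 2; z = v $ 3 in
     [: - ((x * y + z\<^sup>2 - R) / x), 2 * z / x, - (1 / x), 1 :])"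

definition triples :: "'a::field set set" where
  "triples = {A. card A = 3 \<and> (\<Sum>a\<in>A. a) \<noteq> 0}"

text \<open>Well defined in characteristic other than two, by \<open>Psi_bij\<close> below.\<close>
definition tc_point :: "'a::field \<Rightarrow> 'a set \<Rightarrow> 'a ^ 3" where
  "tc_point R A = (THE p. p $ 1 \<noteq> 0 \<and> Psi R p = (\<Prod>a\<in>A. [:- a, 1:]))"

definition P_tc :: "'a::field \<Rightarrow> ('a ^ 3) set" where
  "P_tc R = tc_point R ` triples"

text \<open>The value of \<open>K\<close> as a function of the field size alone, namely \<open>2 * sqrt N / q powr (3/2)\<close>
  with \<open>N = (q - 1)\<^sup>2 * (q - 2) / 6\<close>. The limit over all finite fields is a limit of this sequence:
  a single formula cannot quantify over the field types.\<close>
definition tc_K :: "nat \<Rightarrow> real" where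
  "tc_K q = 2 * sqrt ((real q - 1)\<^sup>2 * (real q - 2) / 6) / real q powr (3 / 2)"

lemma Q0_nondegenerate:
  assumes "(2::'a::field) \<noteq> 0"
  shows "quadratic_form (Q0 :: 'a ^ 3 \<Rightarrow> 'a)" "nondegenerate (Q0 :: 'a ^ 3 \<Rightarrow> 'a)"
proof -
  let ?M = "vector [vector [0, 1, 0], vector [0, 0, 0], vector [0, 0, 1]] :: 'a ^ 3 ^ 3"
  show "quadratic_form (Q0 :: 'a ^ 3 \<Rightarrow> 'a)"
    unfolding quadratic_form_def Q0_def
    by (rule exI[of _ ?M]) (simp add: sum_3 power2_eq_square)
  have B: "polar_form Q0 x y = x $ 1 * y $ 2 + x $ 2 * y $ 1 + 2 * x $ 3 * y $ 3" for x y :: "'a ^ 3"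
    by (simp add: polar_form_def Q0_def power2_eq_square algebra_simps)
  show "nondegenerate (Q0 :: 'a ^ 3 \<Rightarrow> 'a)"
    unfolding nondegenerate_def
  proof (intro allI impI)
    fix x :: "'a ^ 3" assume *: "\<forall>y. polar_form Q0 x y = 0"
    show "x = 0"
      using *[rule_format, of "vector [1, 0, 0]"] *[rule_format, of "vector [0, 1, 0]"]
        *[rule_format, of "vector [0, 0, 1]"] assms
      by (simp add: B vec_eq_iff forall_3)
  qed
qed

lemma Psi_bij:
  fixes R :: "'a::field"
  assumes two: "(2::'a) \<noteq> 0"
  shows "bij_betw (Psi R) {p. p $ 1 \<noteq> 0} {[:- s3, s2, - s1, 1:] | s1 s2 s3. s1 \<noteq> 0}"
  unfolding bij_betw_def
proof
  show "inj_on (Psi R) {p. p $ 1 \<noteq> 0}"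
  proof (rule inj_onI)
    fix p p' :: "'a ^ 3"
    assume "p \<in> {p. p $ 1 \<noteq> 0}" "p' \<in> {p. p $ 1 \<noteq> 0}" and eq: "Psi R p = Psi R p'"
    then have n: "p $ 1 \<noteq> 0" "p' $ 1 \<noteq> 0" by auto
    have 1: "p $ 1 = p' $ 1" using eq n by (auto simp: Psi_def Let_def)
    have 3: "p $ 3 = p' $ 3" using eq n 1 two by (auto simp: Psi_def Let_def)
    have 2: "p $ 2 = p' $ 2" using eq n 1 3 by (auto simp: Psi_def Let_def)
    show "p = p'" using 1 2 3 by (simp add: vec_eq_iff forall_3)
  qed
  show "Psi R ` {p. p $ 1 \<noteq> 0} = {[:- s3, s2, - s1, 1:] | s1 s2 s3. s1 \<noteq> 0}"
  proof (intro equalityI subsetI)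
    fix f assume "f \<in> Psi R ` {p. p $ 1 \<noteq> 0}"
    then obtain p where "p $ 1 \<noteq> 0" "f = Psi R p" by auto
    then show "f \<in> {[:- s3, s2, - s1, 1:] | s1 s2 s3. s1 \<noteq> 0}"
      by (auto simp: Psi_def Let_def
          intro!: exI[of _ "1 / p $ 1"] exI[of _ "(p $ 1 * p $ 2 + (p $ 3)\<^sup>2 - R) / p $ 1"])
  next
    fix f :: "'a poly" assume "f \<in> {[:- s3, s2, - s1, 1:] | s1 s2 s3. s1 \<noteq> 0}"
    then obtain s1 s2 s3 where f: "f = [:- s3, s2, - s1, 1:]" and s1: "s1 \<noteq> 0" by auto
    define z where "z = s2 / (2 * s1)"
    define y where "y = s1 * (s3 / s1 - z\<^sup>2 + R)"
    have "Psi R (vector [1 / s1, y, z]) = f"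
      using s1 two by (simp add: Psi_def Let_def f y_def z_def)
    moreover have "vector [1 / s1, y, z] \<in> {p :: 'a ^ 3. p $ 1 \<noteq> 0}" using s1 by simp
    ultimately show "f \<in> Psi R ` {p. p $ 1 \<noteq> 0}" by (metis imageI)
  qed
qed

end

theory Submission
  imports Defs "HOL-Real_Asymp.Real_Asymp"
begin

text \<open>A point with \<open>x \<noteq> 0\<close> lies on the sphere with parameter \<open>t\<close> iff \<open>t\<close> is a root of its cubic,
  so the incidences are those of three-element sets with their elements. Translating by
  \<open>h\<close> shifts the sum of a triple by \<open>3 h\<close>, hence all sums are equally frequent.

  In a block decomposition with class sizes \<open>n\<^sub>i\<close>, the degrees of a point into the classes sum to
  three, so having almost no positive off-diagonal discrepancy forces a proportion of at least
  about \<open>n\<^sub>i / q\<close> of the points of \<open>A\<^sub>i\<close> to have all three spheres in \<open>T\<^sub>i\<close>. There are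
  at most \<open>n\<^sub>i\<^sup>3 / 6\<close> such points, whence \<open>\<bar>A\<^sub>i\<bar>\<close> is essentially at most \<open>q n\<^sub>i\<^sup>2 / 6\<close>.
  The diagonal discrepancies give \<open>n\<^sub>i \<ge> \<tau> q / 2\<close>, and with at least two classes the sum
  \<open>\<Sum> q n\<^sub>i\<^sup>2 / 6\<close> falls short of the number of points.

  An isotropic vector, completed to a hyperbolic pair and an orthogonal vector, exhibits every
  nondegenerate ternary form as a multiple of \<open>Q0\<close> up to a linear change of coordinates.\<close>

section \<open>The twisted cubic system\<close>

lemma CHAR_neq_imp_two_neq_0:
  assumes "CHAR('a::field) \<noteq> 2" shows "(2::'a) \<noteq> 0"
proof
  assume "(2::'a) = 0"
  then have "of_nat 2 = (0::'a)" by simp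
  then have "CHAR('a) dvd 2" by (simp only: of_nat_eq_0_iff_char_dvd)
  then have "CHAR('a) = 1 \<or> CHAR('a) = 2" using two_is_prime_nat prime_nat_iff by blast
  then show False using assms CHAR_not_1 by auto
qed

lemma CHAR_neq_imp_three_neq_0:
  assumes "CHAR('a::field) \<noteq> 3" shows "(3::'a) \<noteq> 0"
proof
  assume "(3::'a) = 0"
  then have "of_nat 3 = (0::'a)" by simp
  then have "CHAR('a) dvd 3" by (simp only: of_nat_eq_0_iff_char_dvd)
  moreover have "prime (3::nat)" by simp
  ultimately have "CHAR('a) = 1 \<or> CHAR('a) = 3" using prime_nat_iff by blast
  then show False using assms CHAR_not_1 by auto
qed

section \<open>Spheres as point sets and their parameters\<close>

text \<open>For every \<open>x \<noteq> 0\<close> and every \<open>z\<close> some \<open>y\<close>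
  puts \<open>(x, y, z)\<close> on the quadric of radius \<open>r'\<close>. A few such points,
  substituted into the other equation, already determine the shift of the centre. Spheres, which are
  sets of points, can thus be identified with their parameters.\<close>

lemma qsphere_Q0_inject:
  fixes c c' :: "'a::field ^ 3"
  assumes two: "(2::'a) \<noteq> 0" and eq: "qsphere Q0 c r = qsphere Q0 c' r'"
  shows "c = c'" "r = r'"
proof -
  define d where "d = c' - c"
  have *: "(x + d $ 1) * ((r' - z\<^sup>2) / x + d $ 2) + (z + d $ 3)\<^sup>2 = r" if "x \<noteq> 0" for x z
  proof -
    define w :: "'a ^ 3" where "w = vector [x, (r' - z\<^sup>2) / x, z]"
    have "c' + w \<in> qsphere Q0 c' r'"
      using that by (simp add: qsphere_def Q0_def w_def)
    then have "c' + w \<in> qsphere Q0 c r" using eq by simp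
    then have "Q0 (w + d) = r" by (simp add: qsphere_def d_def algebra_simps)
    then show ?thesis by (simp add: Q0_def w_def)
  qed
  \<comment> \<open>The points with \<open>(x, z)\<close> equal to \<open>(1, 0)\<close>,
    \<open>(1, 1)\<close>, \<open>(1, - 1)\<close> and \<open>(- 1, 0)\<close>. The second and third
    give \<open>4 * d $ 3 = 0\<close>, the first two then \<open>d $ 1 = 0\<close>, and the first
    and last \<open>2 * d $ 2 = 0\<close>.\<close>
  have e: "(1 + d $ 1) * (r' + d $ 2) + (d $ 3)\<^sup>2 = r"
    "(1 + d $ 1) * (r' - 1 + d $ 2) + (1 + d $ 3)\<^sup>2 = r"
    "(1 + d $ 1) * (r' - 1 + d $ 2) + (d $ 3 - 1)\<^sup>2 = r"
    "(d $ 1 - 1) * (d $ 2 - r') + (d $ 3)\<^sup>2 = r"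
    using *[of 1 0] *[of 1 1] *[of 1 "- 1"] *[of "- 1" 0] by (simp_all add: algebra_simps)
  have "(1 + d $ 3)\<^sup>2 = (d $ 3 - 1)\<^sup>2" using e(2,3) by (metis add_left_cancel)
  then have "2 * d $ 3 + 2 * d $ 3 = 0" by (simp add: power2_eq_square algebra_simps)
  then have "2 * (2 * d $ 3) = 0" by (simp only: mult_2)
  then have "2 * d $ 3 = 0" using two by (metis mult_eq_0_iff)
  then have d3: "d $ 3 = 0" using two by simp
  have d1: "d $ 1 = 0" using e(1,2) d3 by (simp add: algebra_simps)
  have "2 * d $ 2 = 0" using e(1,4) d1 d3 by (simp add: algebra_simps)
  then have d2: "d $ 2 = 0" using two by simp
  have "d = 0" using d1 d2 d3 by (simp add: vec_eq_iff forall_3)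
  then show "c = c'" by (simp add: d_def)
  show "r = r'" using e(1) d1 d2 d3 by simp
qed

lemma tc_center_inject: "tc_center s = tc_center t \<longleftrightarrow> s = t"
  by (metis tc_center_def vector_3(3))

lemma inj_tc_sphere:
  assumes "(2::'a::field) \<noteq> 0"
  shows "inj (tc_sphere (R::'a))"
  unfolding inj_def tc_sphere_def using qsphere_Q0_inject(1)[OF assms] tc_center_inject by blast

lemma S_tc_eq: "S_tc R = range (tc_sphere R)"
  by (auto simp: S_tc_def)

lemma card_S_tc:
  assumes "(2::'a::{field,finite}) \<noteq> 0"
  shows "card (S_tc (R::'a)) = CARD('a)"
  by (simp add: S_tc_eq card_image inj_tc_sphere assms)

section \<open>The lifted parabola and coaxal pencils\<close>

abbreviation (input) tc_lift :: "'a::field \<Rightarrow> 'a \<Rightarrow> 'a ^ 4" where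
  "tc_lift R t \<equiv> sphere_lift Q0 (tc_center t) R"

lemma tc_lift_nth: "tc_lift R t $ 3 = 2 * t" "tc_lift R t $ 4 = R - t\<^sup>2"
  by (simp_all add: sphere_lift_def tc_center_def Q0_def vector_def)

lemma inj_tc_lift:
  assumes "(2::'a::field) \<noteq> 0"
  shows "inj (tc_lift (R::'a))"
proof (rule injI)
  fix s t assume "tc_lift R s = tc_lift R t"
  then have "2 * s = 2 * t" by (metis tc_lift_nth(1))
  then show "s = t" using assms by simp
qed

text \<open>The last two coordinates of the lifts trace a parabola.\<close>
lemma tc_lift_not_collinear:
  fixes R :: "'a::field"
  assumes two: "(2::'a) \<noteq> 0" and L: "affine_line L"
    and mem: "tc_lift R a \<in> L" "tc_lift R b \<in> L" "tc_lift R c \<in> L"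
    and ab: "a \<noteq> b" and bc: "b \<noteq> c" and ac: "a \<noteq> c"
  shows False
proof -
  obtain u v where Luv: "L = {u + s *s v | s. True}"
    using L by (auto simp: affine_line_def)
  have *: "\<exists>s. 2 * t = u $ 3 + s * v $ 3 \<and> R - t\<^sup>2 = u $ 4 + s * v $ 4" if t: "tc_lift R t \<in> L" for t
  proof -
    obtain s where "tc_lift R t = u + s *s v" using t unfolding Luv by blast
    then have "tc_lift R t $ 3 = u $ 3 + s * v $ 3" "tc_lift R t $ 4 = u $ 4 + s * v $ 4"
      by simp_all
    then show ?thesis by (auto simp: tc_lift_nth)
  qed
  obtain s1 s2 s3 where s:
    "2 * a = u $ 3 + s1 * v $ 3" "R - a\<^sup>2 = u $ 4 + s1 * v $ 4"
    "2 * b = u $ 3 + s2 * v $ 3" "R - b\<^sup>2 = u $ 4 + s2 * v $ 4"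
    "2 * c = u $ 3 + s3 * v $ 3" "R - c\<^sup>2 = u $ 4 + s3 * v $ 4"
    using *[OF mem(1)] *[OF mem(2)] *[OF mem(3)] by metis
  \<comment> \<open>The chord of the parabola \<open>(2 * t, R - t\<^sup>2)\<close> through the
    parameters \<open>x\<close> and \<open>y\<close> has slope \<open>- (x + y) / 2\<close>, which
    must be the slope of the line; the relation is written without division.\<close>
  have 0: "v $ 3 * (x + y) + 2 * v $ 4 = 0"
    if st: "2 * x = u $ 3 + s * v $ 3" "R - x\<^sup>2 = u $ 4 + s * v $ 4"
      "2 * y = u $ 3 + t * v $ 3" "R - y\<^sup>2 = u $ 4 + t * v $ 4" "x \<noteq> y" for s t x y
  proof -
    have "2 * x \<noteq> 2 * y" using st(5) two by simp
    then have "s \<noteq> t" using st(1,3) by auto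
    have 1: "(s - t) * v $ 3 = 2 * x - 2 * y" unfolding st(1,3) by (simp add: algebra_simps)
    have 2: "(s - t) * v $ 4 = (R - x\<^sup>2) - (R - y\<^sup>2)" unfolding st(2,4) by (simp add: algebra_simps)
    have "(s - t) * (v $ 3 * (x + y) + 2 * v $ 4) = (s - t) * v $ 3 * (x + y) + 2 * ((s - t) * v $ 4)"
      by (simp add: algebra_simps)
    also have "\<dots> = 0" unfolding 1 2 by (simp add: algebra_simps power2_eq_square)
    finally show ?thesis using \<open>s \<noteq> t\<close> by simp
  qed
  have "v $ 3 * (a + b) + 2 * v $ 4 = 0" "v $ 3 * (a + c) + 2 * v $ 4 = 0"
    using 0[OF s(1-4) ab] 0[OF s(1,2,5,6) ac] .
  \<comment> \<open>Two chords through \<open>a\<close> can only share a direction if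
    \<open>v $ 3 = 0\<close>, and then the third coordinates \<open>2 * a\<close> and
    \<open>2 * b\<close> coincide.\<close>
  then have "v $ 3 * (a + b) = v $ 3 * (a + c)" by (metis add_right_cancel)
  then have "v $ 3 * (b - c) = 0" by (simp add: algebra_simps)
  then have "v $ 3 = 0" using bc by simp
  then have "2 * a = 2 * b" using s by simp
  then show False using ab two by simp
qed

lemma card_less_3I:
  assumes "\<And>x y z. x \<in> X \<Longrightarrow> y \<in> X \<Longrightarrow> z \<in> X \<Longrightarrow> x \<noteq> y \<Longrightarrow> y \<noteq> z \<Longrightarrow> x \<noteq> z \<Longrightarrow> False"
  shows "card X < 3"
proof (rule ccontr)
  assume "\<not> card X < 3"
  then obtain Y where "Y \<subseteq> X" "card Y = 3"
    by (meson not_less obtain_subset_with_card_n)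
  then obtain x y z where "Y = {x, y, z}" "x \<noteq> y" "y \<noteq> z" "x \<noteq> z"
    by (auto simp: card_3_iff)
  with \<open>Y \<subseteq> X\<close> show False using assms[of x y z] by auto
qed

lemma card_line_Int_tc_lifts:
  fixes R :: "'a::field"
  assumes two: "(2::'a) \<noteq> 0" and L: "affine_line L"
  shows "card (L \<inter> range (tc_lift R)) < 3"
proof (rule card_less_3I)
  fix x y z
  assume "x \<in> L \<inter> range (tc_lift R)" "y \<in> L \<inter> range (tc_lift R)" "z \<in> L \<inter> range (tc_lift R)"
    and ne: "x \<noteq> y" "y \<noteq> z" "x \<noteq> z"
  then obtain a b c where "x = tc_lift R a" "y = tc_lift R b" "z = tc_lift R c"
    "x \<in> L" "y \<in> L" "z \<in> L" by blast
  then show False using tc_lift_not_collinear[OF two L, of a R b c] ne by blast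
qed

text \<open>A member of the pencil could a priori be the sphere \<open>tc_sphere R t\<close> under
  other parameters. As the parameters are unique, its lift is \<open>tc_lift R t\<close>, and three
  members would give three collinear points of the parabola.\<close>

lemma card_coaxal_pencil_Int_S_tc:
  fixes R :: "'a::field"
  assumes two: "(2::'a) \<noteq> 0" and C: "coaxal_pencil Q0 C"
  shows "card (C \<inter> S_tc R) < 3"
proof (rule card_less_3I)
  obtain L where L: "affine_line L" and CL: "C = {qsphere Q0 c r | c r. sphere_lift Q0 c r \<in> L}"
    using C by (auto simp: coaxal_pencil_def)
  have *: "\<exists>t. x = tc_sphere R t \<and> tc_lift R t \<in> L" if x: "x \<in> C \<inter> S_tc R" for x
  proof -
    obtain t where t: "x = tc_sphere R t" using x by (auto simp: S_tc_def)
    obtain c r where cr: "x = qsphere Q0 c r" "sphere_lift Q0 c r \<in> L" using x CL by auto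
    have "c = tc_center t" "r = R"
      using qsphere_Q0_inject[OF two, of c r "tc_center t" R] cr(1) t by (simp_all add: tc_sphere_def)
    then show ?thesis using t cr by auto
  qed
  fix x y z
  assume "x \<in> C \<inter> S_tc R" "y \<in> C \<inter> S_tc R" "z \<in> C \<inter> S_tc R" and ne: "x \<noteq> y" "y \<noteq> z" "x \<noteq> z"
  then obtain a b c where "x = tc_sphere R a" "y = tc_sphere R b" "z = tc_sphere R c"
    "tc_lift R a \<in> L" "tc_lift R b \<in> L" "tc_lift R c \<in> L" using * by metis
  then show False using tc_lift_not_collinear[OF two L, of a R b c] ne by blast
qed

section \<open>Cubics and incidences\<close>

text \<open>As a polynomial in \<open>t\<close>, \<open>Q0 (p - tc_center t) - R\<close> is a cubic
  with leading coefficient \<open>- p $ 1\<close>; made monic, it is \<open>Psi R p\<close>.\<close>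

lemma mem_tc_sphere_iff_poly:
  assumes "p $ 1 \<noteq> 0"
  shows "p \<in> tc_sphere R t \<longleftrightarrow> poly (Psi R p) t = 0"
proof -
  have "p \<in> tc_sphere R t \<longleftrightarrow> p $ 1 * (p $ 2 - t ^ 3) + (p $ 3 - t)\<^sup>2 = R"
    by (simp add: tc_sphere_def qsphere_def Q0_def tc_center_def)
  also have "\<dots> \<longleftrightarrow> p $ 1 * (p $ 2 - t ^ 3) + (p $ 3 - t)\<^sup>2 - R = 0" by simp
  also have "p $ 1 * (p $ 2 - t ^ 3) + (p $ 3 - t)\<^sup>2 - R = - p $ 1 * poly (Psi R p) t"
    using assms
    by (simp add: Psi_def Let_def algebra_simps add_divide_distrib diff_divide_distrib
        power2_eq_square power3_eq_cube)
  finally show ?thesis using assms by simp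
qed

text \<open>By Vieta, the nonzero sum of a triple is the coefficient \<open>s1\<close> in
  \<open>Psi_bij\<close>. Hence exactly one point with nonzero first coordinate has the required
  cubic, and the definite description denotes it.\<close>

lemma tc_point_props:
  fixes R :: "'a::field"
  assumes two: "(2::'a) \<noteq> 0" and A: "A \<in> triples"
  shows "tc_point R A $ 1 \<noteq> 0" "Psi R (tc_point R A) = (\<Prod>a\<in>A. [:- a, 1:])"
proof -
  obtain a b c where abc: "A = {a, b, c}" "a \<noteq> b" "b \<noteq> c" "a \<noteq> c"
    using A by (auto simp: triples_def card_3_iff)
  have "a + (b + c) \<noteq> 0" using A abc by (auto simp: triples_def)
  moreover have "(\<Prod>a\<in>A. [:- a, 1:]) = [:- (a * b * c), a * b + b * c + a * c, - (a + (b + c)), 1:]"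
    using abc by (simp add: algebra_simps)
  ultimately have "(\<Prod>a\<in>A. [:- a, 1:]) \<in> {[:- s3, s2, - s1, 1:] | s1 s2 s3. s1 \<noteq> 0}"
    by blast
  then have "(\<Prod>a\<in>A. [:- a, 1:]) \<in> Psi R ` {p. p $ 1 \<noteq> 0}"
    unfolding bij_betw_imp_surj_on[OF Psi_bij[OF two]] .
  then obtain p where p: "p $ 1 \<noteq> 0" "Psi R p = (\<Prod>a\<in>A. [:- a, 1:])" by force
  have "\<exists>!p. p $ 1 \<noteq> 0 \<and> Psi R p = (\<Prod>a\<in>A. [:- a, 1:])"
    by (rule ex1I[of _ p])
      (use p inj_onD[OF bij_betw_imp_inj_on[OF Psi_bij[OF two, of R]]] in auto)
  from theI'[OF this] show "tc_point R A $ 1 \<noteq> 0" "Psi R (tc_point R A) = (\<Prod>a\<in>A. [:- a, 1:])"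
    by (simp_all add: tc_point_def)
qed

lemma finite_triple: "A \<in> triples \<Longrightarrow> finite A"
  by (auto simp: triples_def intro: card_ge_0_finite)

lemma tc_point_mem_tc_sphere_iff:
  fixes R :: "'a::field"
  assumes "(2::'a) \<noteq> 0" "A \<in> triples"
  shows "tc_point R A \<in> tc_sphere R t \<longleftrightarrow> t \<in> A"
proof -
  have "tc_point R A \<in> tc_sphere R t \<longleftrightarrow> (\<Prod>a\<in>A. - a + t) = 0"
    by (simp add: mem_tc_sphere_iff_poly tc_point_props[OF assms] poly_prod)
  then show ?thesis using finite_triple[OF assms(2)] by auto
qed

text \<open>A triple is recovered from its point as the set of parameters of the spheres through
  it.\<close>

lemma inj_on_tc_point:
  assumes "(2::'a::field) \<noteq> 0"
  shows "inj_on (tc_point (R::'a)) triples"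
proof (rule inj_onI)
  fix A B :: "'a set"
  assume "A \<in> triples" "B \<in> triples" "tc_point R A = tc_point R B"
  then have "t \<in> A \<longleftrightarrow> t \<in> B" for t
    using tc_point_mem_tc_sphere_iff[OF assms, of A R t] tc_point_mem_tc_sphere_iff[OF assms, of B R t]
    by simp
  then show "A = B" by blast
qed

section \<open>Counting triples by their sum\<close>

lemma card_sum_eq:
  fixes s :: "'a::{field,finite}"
  assumes three: "(3::'a) \<noteq> 0"
  shows "card {A :: 'a set. card A = 3 \<and> (\<Sum>a\<in>A. a) = s} = card {A :: 'a set. card A = 3 \<and> (\<Sum>a\<in>A. a) = 0}"
proof -
  let ?F = "\<lambda>s. {A :: 'a set. card A = 3 \<and> (\<Sum>a\<in>A. a) = s}"
  have le: "card (?F s) \<le> card (?F (s + 3 * h))" for s h :: 'a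
  proof (rule card_inj_on_le)
    show "inj_on ((`) ((+) h)) (?F s)" by (rule inj_onI) (simp add: inj_image_eq_iff)
    show "(`) ((+) h) ` ?F s \<subseteq> ?F (s + 3 * h)"
    proof clarify
      fix A :: "'a set" assume "card A = 3"
      then show "card ((+) h ` A) = 3 \<and> (\<Sum>a\<in>(+) h ` A. a) = (\<Sum>a\<in>A. a) + 3 * h"
        by (simp add: card_image sum.reindex sum.distrib)
    qed
  qed simp
  \<comment> \<open>The shifts by \<open>- s / 3\<close> and \<open>s / 3\<close> give the two
    inequalities; here 3 has to be invertible.\<close>
  show ?thesis using le[of s "- s / 3"] le[of 0 "s / 3"] three by simp
qed

text \<open>Clearing the denominator over the reals avoids truncated subtraction, so this identity
  and its cubic analogue hold for every \<open>n\<close>.\<close>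

lemma choose_two_real: "2 * real (n choose 2) = real n * (real n - 1)"
  by (induction n) (simp_all add: numeral_eq_Suc algebra_simps)

lemma choose_three_real: "6 * real (n choose 3) = real n * (real n - 1) * (real n - 2)"
proof (induction n)
  case (Suc n)
  have "Suc n choose 3 = (n choose 2) + (n choose 3)" by (simp add: numeral_eq_Suc)
  then have "6 * real (Suc n choose 3) = 3 * (2 * real (n choose 2)) + 6 * real (n choose 3)" by simp
  then show ?case unfolding choose_two_real Suc.IH by (simp add: algebra_simps)
qed simp

text \<open>The sum classes, one for each field element, are equally large, so each has
  \<open>(q - 1) * (q - 2) / 6\<close> members, where \<open>q\<close> is the field size. The sets
  with nonzero sum make up all classes but one.\<close>

lemma card_triples:
  assumes three: "(3::'a::{field,finite}) \<noteq> 0"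
  shows "real (card (triples :: 'a set set)) = (real CARD('a) - 1)\<^sup>2 * (real CARD('a) - 2) / 6"
proof -
  let ?q = "CARD('a)"
  define F where "F = (\<lambda>s. {A :: 'a set. card A = 3 \<and> (\<Sum>a\<in>A. a) = s})"
  have choose: "card {A :: 'a set. card A = 3} = ?q choose 3"
    using n_subsets[of "UNIV :: 'a set" 3] by simp
  have "{A. card A = 3} = (\<Union>s. F s)" by (auto simp: F_def)
  then have "?q choose 3 = card (\<Union>s. F s)" using choose by simp
  also have "\<dots> = (\<Sum>s\<in>UNIV. card (F s))"
    by (rule card_UN_disjoint) (auto simp: F_def)
  also have "\<dots> = (\<Sum>s\<in>(UNIV :: 'a set). card (F 0))"
    unfolding F_def by (rule sum.cong[OF refl card_sum_eq[OF three]])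
  also have "\<dots> = ?q * card (F 0)" by simp
  finally have "real (?q choose 3) = real ?q * real (card (F 0))"
    by (metis of_nat_mult)
  then have "real ?q * (6 * real (card (F 0))) = real ?q * ((real ?q - 1) * (real ?q - 2))"
    using choose_three_real[of ?q] by (simp only: mult.assoc mult.left_commute)
  then have F0: "6 * real (card (F 0)) = (real ?q - 1) * (real ?q - 2)"
    by (rule mult_left_cancel[THEN iffD1, rotated]) simp
  have "{A. card A = 3} = triples \<union> F 0" by (auto simp: triples_def F_def)
  then have "?q choose 3 = card (triples \<union> F 0)" using choose by simp
  also have "\<dots> = card (triples :: 'a set set) + card (F 0)"
    by (rule card_Un_disjoint) (auto simp: triples_def F_def)
  finally have "6 * real (card (triples :: 'a set set)) = 6 * real (?q choose 3) - 6 * real (card (F 0))"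
    by simp
  also have "\<dots> = (real ?q - 1)\<^sup>2 * (real ?q - 2)"
    unfolding choose_three_real F0 by (simp add: algebra_simps power2_eq_square)
  finally show ?thesis by simp
qed

lemma card_P_tc:
  assumes "(2::'a::{field,finite}) \<noteq> 0" "(3::'a) \<noteq> 0"
  shows "real (card (P_tc (R::'a))) = (real CARD('a) - 1)\<^sup>2 * (real CARD('a) - 2) / 6"
  by (simp add: P_tc_def card_image inj_on_tc_point assms card_triples)

section \<open>Degrees and intersections\<close>

lemma spheres_through_tc_point:
  fixes R :: "'a::field"
  assumes "(2::'a) \<noteq> 0" "A \<in> triples"
  shows "{S \<in> S_tc R. tc_point R A \<in> S} = tc_sphere R ` A"
  by (auto simp: S_tc_eq tc_point_mem_tc_sphere_iff[OF assms])

lemma degree_P_tc: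
  fixes R :: "'a::field"
  assumes two: "(2::'a) \<noteq> 0" and p: "p \<in> P_tc R"
  shows "card {S \<in> S_tc R. p \<in> S} = 3"
proof -
  obtain A where A: "A \<in> triples" "p = tc_point R A" using p by (auto simp: P_tc_def)
  then have "card A = 3" by (simp add: triples_def)
  then show ?thesis
    using A by (simp add: spheres_through_tc_point[OF two] card_image inj_on_subset[OF inj_tc_sphere[OF two]])
qed

text \<open>The three spheres through a point name the elements of its triple. Points whose spheres
  all lie in one class can therefore be counted by three-element subsets of that class.\<close>

lemma inj_on_spheres_through:
  assumes two: "(2::'a::field) \<noteq> 0"
  shows "inj_on (\<lambda>p. {S \<in> S_tc (R::'a). p \<in> S}) (P_tc R)"
proof (rule inj_onI)
  fix p p' assume "p \<in> P_tc R" "p' \<in> P_tc R" and eq: "{S \<in> S_tc R. p \<in> S} = {S \<in> S_tc R. p' \<in> S}"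
  then obtain A A' where "A \<in> triples" "p = tc_point R A" "A' \<in> triples" "p' = tc_point R A'"
    by (auto simp: P_tc_def)
  then show "p = p'"
    using eq by (simp add: spheres_through_tc_point[OF two] inj_image_eq_iff[OF inj_tc_sphere[OF two]])
qed

text \<open>Removing \<open>t\<close> turns a triple containing \<open>t\<close> into a pair of
  other field elements; forgetting the condition on the sum only enlarges the count.\<close>

lemma card_P_tc_Int_sphere:
  fixes R :: "'a::{field,finite}"
  assumes two: "(2::'a) \<noteq> 0" and S: "S \<in> S_tc R"
  shows "real (card (P_tc R \<inter> S)) \<le> (real CARD('a) - 1) * (real CARD('a) - 2) / 2"
proof -
  let ?q = "CARD('a)"
  obtain t where t: "S = tc_sphere R t" using S by (auto simp: S_tc_def)
  let ?X = "{A \<in> triples. t \<in> A}"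
  have "P_tc R \<inter> S = tc_point R ` ?X"
    by (auto simp: P_tc_def t tc_point_mem_tc_sphere_iff[OF two])
  then have "card (P_tc R \<inter> S) \<le> card ?X" by (simp add: card_image_le)
  also have "\<dots> \<le> card {B. B \<subseteq> UNIV - {t} \<and> card B = 2}"
  proof (rule card_inj_on_le[where f = "\<lambda>A. A - {t}"])
    show "inj_on (\<lambda>A. A - {t}) ?X" by (rule inj_onI) blast
  qed (auto simp: triples_def card_Diff_singleton)
  also have "\<dots> = (?q - 1) choose 2" by (simp add: n_subsets card_Diff_singleton)
  finally have "card (P_tc R \<inter> S) \<le> (?q - 1) choose 2" .
  then have "real (card (P_tc R \<inter> S)) \<le> real ((?q - 1) choose 2)" by simp
  also have "\<dots> = (real ?q - 1) * (real ?q - 2) / 2"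
    using choose_two_real[of "?q - 1"] by (simp add: of_nat_diff Suc_leI)
  finally show ?thesis .
qed

text \<open>The third element of a triple containing \<open>a\<close> and \<open>b\<close> has to
  avoid \<open>a\<close>, \<open>b\<close> and, as the sum is nonzero,
  \<open>- a - b\<close>.\<close>

lemma card_P_tc_Int_two_spheres:
  fixes R :: "'a::{field,finite}"
  assumes two: "(2::'a) \<noteq> 0" and ab: "a \<noteq> b"
  shows "CARD('a) - 3 \<le> card (P_tc R \<inter> tc_sphere R a \<inter> tc_sphere R b)"
    and "card (P_tc R \<inter> tc_sphere R a \<inter> tc_sphere R b) \<le> CARD('a) - 2"
proof -
  let ?X = "UNIV - {a, b, - a - b}"
  have "{A \<in> triples. a \<in> A \<and> b \<in> A} = (\<lambda>c. {a, b, c}) ` ?X"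
  proof (intro equalityI subsetI)
    fix A assume "A \<in> {A \<in> triples. a \<in> A \<and> b \<in> A}"
    then have A: "card A = 3" "(\<Sum>x\<in>A. x) \<noteq> 0" "a \<in> A" "b \<in> A" by (auto simp: triples_def)
    have "card (A - {a, b}) = 1" using A(1,3,4) ab by (simp add: card_Diff_subset)
    then obtain c where "A - {a, b} = {c}" by (rule card_1_singletonE)
    then have c: "A = {a, b, c}" "c \<noteq> a" "c \<noteq> b" using A(3,4) by blast+
    have "a + (b + c) \<noteq> 0" using A(2) c ab by simp
    then have "c \<noteq> - a - b" by auto
    then show "A \<in> (\<lambda>c. {a, b, c}) ` ?X" using c by auto
  next
    fix A assume "A \<in> (\<lambda>c. {a, b, c}) ` ?X"
    then obtain c where c: "A = {a, b, c}" "c \<noteq> a" "c \<noteq> b" "c \<noteq> - a - b" by auto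
    have "a + (b + c) \<noteq> 0"
    proof
      assume "a + (b + c) = 0"
      then have "c = - (a + b)" by (metis add.assoc add_eq_0_iff)
      then show False using c(4) by simp
    qed
    then show "A \<in> {A \<in> triples. a \<in> A \<and> b \<in> A}"
      using ab c by (simp add: triples_def)
  qed
  moreover have "P_tc R \<inter> tc_sphere R a \<inter> tc_sphere R b = tc_point R ` {A \<in> triples. a \<in> A \<and> b \<in> A}"
    by (auto simp: P_tc_def tc_point_mem_tc_sphere_iff[OF two])
  moreover have "inj_on (tc_point R) {A \<in> triples. a \<in> A \<and> b \<in> A}"
    by (rule inj_on_subset[OF inj_on_tc_point[OF two]]) auto
  moreover have "inj_on (\<lambda>c. {a, b, c}) ?X" by (rule inj_onI) auto
  ultimately have *: "card (P_tc R \<inter> tc_sphere R a \<inter> tc_sphere R b) = card ?X"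
    by (simp add: card_image)
  \<comment> \<open>\<open>- a - b\<close> may coincide with \<open>a\<close> or \<open>b\<close>,
    so two or three elements are excluded; hence the gap between the two bounds.\<close>
  have "card {a, b, - a - b} \<le> 3" by (simp add: card_insert_if)
  moreover have "card {a, b} \<le> card {a, b, - a - b}" by (rule card_mono) auto
  ultimately have "card {a, b, - a - b} \<le> 3" "2 \<le> card {a, b, - a - b}" using ab by auto
  then show "CARD('a) - 3 \<le> card (P_tc R \<inter> tc_sphere R a \<inter> tc_sphere R b)"
    "card (P_tc R \<inter> tc_sphere R a \<inter> tc_sphere R b) \<le> CARD('a) - 2"
    unfolding * by (auto simp: card_Diff_subset)
qed

lemma inc_iso_D30:
  fixes R :: "'a::{field,finite}"
  assumes two: "(2::'a) \<noteq> 0"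
  shows "inc_iso (tc_point R) (tc_sphere R) D30 (sphere_system (P_tc R) (S_tc R))"
proof -
  have "{A :: 'a set. card A = 3 \<and> - (\<Sum>a\<in>A. a) \<noteq> 0} = triples" by (simp add: triples_def)
  then show ?thesis
    by (simp add: tc_point_mem_tc_sphere_iff[OF two] inc_iso_def D30_def sphere_system_def P_tc_def S_tc_eq bij_betw_def
        inj_on_tc_point[OF two] inj_tc_sphere[OF two])
qed

section \<open>Centered block decompositions\<close>

text \<open>Double counting: the sum over points brings in degrees, while its counterpart over
  spheres brings in sphere sizes and makes the discrepancy visibly additive in the family.\<close>

lemma discrepancy_eq_sum_points:
  fixes B :: "('a::{field,finite} ^ 3) set"
  shows "discrepancy B T = (\<Sum>p\<in>B. real (card {s \<in> T. p \<in> s}) - real (card T) / real CARD('a))"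
proof -
  have "{(p, s). p \<in> B \<and> s \<in> T \<and> p \<in> s} = Sigma B (\<lambda>p. {s \<in> T. p \<in> s})" by auto
  then have "incidences B T = (\<Sum>p\<in>B. card {s \<in> T. p \<in> s})"
    by (simp add: incidences_def)
  then show ?thesis by (simp add: discrepancy_def sum_subtractf)
qed

lemma discrepancy_eq_sum_spheres:
  fixes B :: "('a::{field,finite} ^ 3) set"
  shows "discrepancy B T = (\<Sum>s\<in>T. real (card (B \<inter> s)) - real (card B) / real CARD('a))"
proof -
  have "{(p, s). p \<in> B \<and> s \<in> T \<and> p \<in> s} = prod.swap ` Sigma T (\<lambda>s. B \<inter> s)" by auto
  then have "incidences B T = (\<Sum>s\<in>T. card (B \<inter> s))"
    by (simp add: incidences_def card_image)
  then show ?thesis by (simp add: discrepancy_def sum_subtractf)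
qed

text \<open>With as many spheres as field elements, every point contributes 3 - 1 = 2.\<close>

lemma discrepancy_regular:
  fixes P :: "('a::{field,finite} ^ 3) set"
  assumes "card S = CARD('a)" and "\<And>p. p \<in> P \<Longrightarrow> card {s \<in> S. p \<in> s} = 3" and "B \<subseteq> P"
  shows "discrepancy B S = 2 * real (card B)"
proof -
  have "discrepancy B S = (\<Sum>p\<in>B. 2)"
    unfolding discrepancy_eq_sum_points by (rule sum.cong) (use assms in auto)
  then show ?thesis by simp
qed

lemma discrepancy_UN:
  fixes B :: "('a::{field,finite} ^ 3) set"
  assumes "finite I" "disjoint_family_on T I"
  shows "discrepancy B (\<Union>i\<in>I. T i) = (\<Sum>i\<in>I. discrepancy B (T i))"
  unfolding discrepancy_eq_sum_spheres using assms
  by (intro sum.UNION_disjoint) (auto simp: disjoint_family_on_def)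

text \<open>Such a point has all its spheres in \<open>T\<close> and is determined by them, so
  three-element subsets of \<open>T\<close> bound the count.\<close>

lemma card_points_in_class:
  fixes P :: "('a::{field,finite} ^ 3) set"
  assumes deg: "\<And>p. p \<in> P \<Longrightarrow> card {s \<in> S. p \<in> s} = 3"
    and inj: "inj_on (\<lambda>p. {s \<in> S. p \<in> s}) P" and T: "T \<subseteq> S"
  shows "6 * card {p \<in> P. card {s \<in> T. p \<in> s} = 3} \<le> card T ^ 3"
proof -
  let ?M = "{p \<in> P. card {s \<in> T. p \<in> s} = 3}"
  have eq: "{s \<in> S. p \<in> s} = {s \<in> T. p \<in> s}" if "p \<in> ?M" for p
    by (rule card_subset_eq[symmetric]) (use that deg[of p] T in auto)
  have "card ?M \<le> card {B. B \<subseteq> T \<and> card B = 3}"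
  proof (rule card_inj_on_le)
    show "inj_on (\<lambda>p. {s \<in> S. p \<in> s}) ?M" by (rule inj_on_subset[OF inj]) auto
    show "(\<lambda>p. {s \<in> S. p \<in> s}) ` ?M \<subseteq> {B. B \<subseteq> T \<and> card B = 3}" using eq by auto
  qed simp
  also have "\<dots> = card T choose 3" by (simp add: n_subsets)
  finally have "real (6 * card ?M) \<le> 6 * real (card T choose 3)" by simp
  also have "\<dots> = real (card T) * (real (card T) - 1) * (real (card T) - 2)"
    by (rule choose_three_real)
  also have "\<dots> \<le> real (card T) * real (card T) * real (card T)"
  \<comment> \<open>For fewer than two spheres the last factor is negative and monotonicity fails,
    but then the product is 0.\<close>
  proof (cases "card T \<ge> 2")
    case True
    then show ?thesis by (intro mult_mono) auto
  next
    case False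
    then have "card T = 0 \<or> card T = 1" by linarith
    then show ?thesis by auto
  qed
  also have "\<dots> = real (card T ^ 3)" by (simp add: power3_eq_cube)
  finally show ?thesis by linarith
qed

section \<open>Excluding block decompositions\<close>

text \<open>\<open>6 * N\<close> falls short of \<open>q ^ 3\<close> by a proportion of at most
  \<open>\<tau> / 24\<close>, and the terms with \<open>\<epsilon>\<close> cost at most
  \<open>5 * \<tau> / 144\<close>. Together this is less than the \<open>\<tau> / 2\<close> missing
  on the right.\<close>

lemma block_decomposition_numeric:
  fixes q \<tau> \<epsilon> N :: real
  assumes N: "6 * N = (q - 1)\<^sup>2 * (q - 2)" and "0 < \<tau>" "\<tau> \<le> 1" "q \<ge> 96 / \<tau>" "\<epsilon> \<le> \<tau>\<^sup>2 / 144"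
    and le: "(1 - \<epsilon>) * N \<le> q ^ 3 * (1 - \<tau> / 2) / 6 + 4 * \<epsilon> * N / \<tau>"
  shows False
proof -
  have q: "\<tau> * q \<ge> 96" using assms by (simp add: field_simps)
  have "96 / \<tau> \<ge> 96" using assms by (simp add: field_simps)
  then have q96: "q \<ge> 96" using assms by linarith
  have Npos: "N > 0"
  proof -
    have "(q - 1)\<^sup>2 * (q - 2) > 0" using q96 by simp
    then show ?thesis using N by simp
  qed
  have "\<tau>\<^sup>2 \<le> \<tau>" using assms by (simp add: power2_eq_square)
  then have "\<epsilon> \<le> \<tau> / 144" using assms by simp
  moreover have "4 * \<epsilon> / \<tau> \<le> \<tau> / 36"
    using assms by (simp add: field_simps power2_eq_square)
  \<comment> \<open>The losses \<open>\<epsilon>\<close> and \<open>4 * \<epsilon> / \<tau>\<close>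
    are at most \<open>\<tau> / 144\<close> and \<open>4 * \<tau> / 144\<close>.\<close>
  ultimately have "1 - 5 * \<tau> / 144 \<le> 1 - \<epsilon> - 4 * \<epsilon> / \<tau>" by simp
  then have "(1 - 5 * \<tau> / 144) * N \<le> (1 - \<epsilon> - 4 * \<epsilon> / \<tau>) * N"
    using Npos by (intro mult_right_mono) auto
  also have "\<dots> = (1 - \<epsilon>) * N - 4 * \<epsilon> * N / \<tau>" by (simp add: left_diff_distrib)
  also have "\<dots> \<le> q ^ 3 * (1 - \<tau> / 2) / 6" using le by linarith
  finally have 1: "(1 - 5 * \<tau> / 144) * (6 * N) \<le> q ^ 3 * (1 - \<tau> / 2)" by simp
  \<comment> \<open>The leading loss in \<open>6 * N\<close> is \<open>4 * q\<^sup>2\<close>; since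
    \<open>\<tau> * q\<close> is at least 96 = 4 * 24, it is at most
    \<open>q ^ 3 * \<tau> / 24\<close>.\<close>
  have "q ^ 3 * (1 - \<tau> / 24) \<le> 6 * N"
  proof -
    have "q\<^sup>2 * 96 \<le> q\<^sup>2 * (\<tau> * q)" using q by (intro mult_left_mono) auto
    also have "q\<^sup>2 * (\<tau> * q) = q ^ 3 * \<tau>" by (simp add: power2_eq_square power3_eq_cube)
    finally have "4 * q\<^sup>2 \<le> q ^ 3 * \<tau> / 24" by simp
    moreover have "6 * N = q ^ 3 - 4 * q\<^sup>2 + 5 * q - 2"
      unfolding N by (simp add: power2_eq_square power3_eq_cube algebra_simps)
    ultimately show ?thesis using q96 by (simp add: algebra_simps)
  qed
  then have "(1 - 5 * \<tau> / 144) * (q ^ 3 * (1 - \<tau> / 24)) \<le> (1 - 5 * \<tau> / 144) * (6 * N)"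
    using assms by (intro mult_left_mono) auto
  with 1 have "q ^ 3 * ((1 - 5 * \<tau> / 144) * (1 - \<tau> / 24)) \<le> q ^ 3 * (1 - \<tau> / 2)"
    by (simp add: mult_ac)
  then have "(1 - 5 * \<tau> / 144) * (1 - \<tau> / 24) \<le> 1 - \<tau> / 2"
    using q96 by (simp add: mult_le_cancel_left)
  moreover have "(1 - 5 * \<tau> / 144) * (1 - \<tau> / 24) \<ge> 1 - 5 * \<tau> / 144 - \<tau> / 24"
    by (simp add: algebra_simps)
  ultimately show False using assms by linarith
qed

text \<open>Only counting data of the system enter: the degrees, the sizes, and the fact that a
  point is determined by its spheres. The points of the blocks are bounded class by class and the
  bounds are summed.\<close>

lemma no_centered_block_decomposition:
  fixes P :: "('a::{field,finite} ^ 3) set"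
  defines "q \<equiv> real CARD('a)" and "N \<equiv> real (card P)"
  assumes S: "card S = CARD('a)"
    and deg: "\<And>p. p \<in> P \<Longrightarrow> card {s \<in> S. p \<in> s} = 3"
    and inj: "inj_on (\<lambda>p. {s \<in> S. p \<in> s}) P"
    and sph: "\<And>s. s \<in> S \<Longrightarrow> real (card (P \<inter> s)) \<le> (q - 1) * (q - 2) / 2"
    and N: "N = (q - 1)\<^sup>2 * (q - 2) / 6"
    and \<tau>: "0 < \<tau>" "\<tau> \<le> 1" and q: "q \<ge> 96 / \<tau>" and \<epsilon>: "0 \<le> \<epsilon>" "\<epsilon> \<le> \<tau>\<^sup>2 / 144"
  shows "\<not> centered_block_decomposition \<tau> \<epsilon> P S m A R' T"
proof
  assume dec: "centered_block_decomposition \<tau> \<epsilon> P S m A R' T"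
  let ?I = "{1..m}"
  have m: "m \<ge> 2" and ST: "S = (\<Union>i\<in>?I. T i)" and djT: "disjoint_family_on T ?I"
    and PA: "P = (\<Union>i\<in>?I. A i) \<union> R'" and djA: "disjoint_family_on A ?I"
    and AR: "(\<Union>i\<in>?I. A i) \<inter> R' = {}"
    and diag: "\<And>i. i \<in> ?I \<Longrightarrow> discrepancy (A i) (T i) \<ge> \<tau> * discrepancy P S"
    and rest: "discrepancy R' S \<le> \<epsilon> * discrepancy P S"
    and off: "(\<Sum>(i, j)\<in>{(i, j). i \<in> ?I \<and> j \<in> ?I \<and> i \<noteq> j}. max (discrepancy (A i) (T j)) 0)
       \<le> \<epsilon> * discrepancy P S"
    using dec unfolding centered_block_decomposition_def by blast+
  have disc: "discrepancy B S = 2 * real (card B)" if "B \<subseteq> P" for B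
    by (rule discrepancy_regular[OF S deg that])
  have PS: "discrepancy P S = 2 * N" by (simp add: disc N_def)
  have "96 / \<tau> \<ge> 96" using \<tau> by (simp add: field_simps)
  then have q96: "q \<ge> 96" using q by linarith
  \<comment> \<open>\<open>e i\<close> collects the positive off-diagonal discrepancy of row
    \<open>i\<close>; all rows together have at most \<open>2 * \<epsilon> * N\<close>, as the total
    discrepancy is \<open>2 * N\<close>.\<close>
  define n a e where "n i = real (card (T i))" and "a i = real (card (A i))"
    and "e i = (\<Sum>j\<in>?I - {i}. max (discrepancy (A i) (T j)) 0)" for i
  have n_sum: "(\<Sum>i\<in>?I. n i) = q"
  proof -
    have "card S = (\<Sum>i\<in>?I. card (T i))"
      unfolding ST using djT by (intro card_UN_disjoint) (auto simp: disjoint_family_on_def)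
    then show ?thesis by (simp add: S q_def n_def)
  qed
  have e_nonneg: "e i \<ge> 0" for i unfolding e_def by (intro sum_nonneg) simp
  have e_sum: "(\<Sum>i\<in>?I. e i) \<le> 2 * \<epsilon> * N"
  proof -
    have "{(i, j). i \<in> ?I \<and> j \<in> ?I \<and> i \<noteq> j} = Sigma ?I (\<lambda>i. ?I - {i})" by auto
    then show ?thesis using off by (simp add: sum.Sigma[symmetric] e_def PS)
  qed
  have a_sum: "(1 - \<epsilon>) * N \<le> (\<Sum>i\<in>?I. a i)"
  proof -
    have "card (\<Union>i\<in>?I. A i) = (\<Sum>i\<in>?I. card (A i))"
      using djA by (intro card_UN_disjoint) (auto simp: disjoint_family_on_def)
    then have "card P = (\<Sum>i\<in>?I. card (A i)) + card R'"
      unfolding PA using AR by (simp add: card_Un_disjoint)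
    then have "N = (\<Sum>i\<in>?I. a i) + real (card R')" by (simp add: N_def a_def)
    moreover have "discrepancy R' S = 2 * real (card R')" using PA by (intro disc) auto
    ultimately show ?thesis using rest PS by (simp add: algebra_simps)
  qed
  \<comment> \<open>Each sphere of the class contributes at most
    \<open>(q - 1) * (q - 2) / 2\<close> to a diagonal discrepancy of at least
    \<open>2 * \<tau> * N\<close>, so \<open>3 * n i \<ge> 2 * \<tau> * (q - 1)\<close>.\<close>
  have n_low: "n i \<ge> \<tau> * q / 2" if i: "i \<in> ?I" for i
  proof -
    have "\<tau> * (2 * N) \<le> discrepancy (A i) (T i)" using diag[OF i] PS by simp
    also have "\<dots> \<le> (\<Sum>s\<in>T i. (q - 1) * (q - 2) / 2)"
      unfolding discrepancy_eq_sum_spheres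
    proof (rule sum_mono)
      fix s assume "s \<in> T i"
      then have "s \<in> S" using i ST by auto
      have "card (A i \<inter> s) \<le> card (P \<inter> s)" using i PA by (intro card_mono) auto
      then show "real (card (A i \<inter> s)) - real (card (A i)) / real CARD('a) \<le> (q - 1) * (q - 2) / 2"
        using sph[OF \<open>s \<in> S\<close>] by (smt (verit) divide_nonneg_nonneg of_nat_0_le_iff of_nat_mono)
    qed
    also have "\<dots> = n i * ((q - 1) * (q - 2) / 2)" by (simp add: n_def)
    finally have "((q - 1) * (q - 2)) * (2 * \<tau> * (q - 1)) \<le> ((q - 1) * (q - 2)) * (3 * n i)"
      unfolding N by (simp add: power2_eq_square field_simps)
    then have "2 * \<tau> * (q - 1) \<le> 3 * n i" using q96 by (simp add: mult_le_cancel_left)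
    \<comment> \<open>Since \<open>q \<ge> 4\<close>, \<open>q - 1\<close> may be replaced by
      \<open>3 * q / 4\<close>, which gives the rounder bound.\<close>
    moreover have "\<tau> * (3 * q) \<le> \<tau> * (4 * (q - 1))" using \<tau> q96 by (intro mult_left_mono) auto
    ultimately show ?thesis by (simp add: algebra_simps)
  qed
  \<comment> \<open>Since \<open>m \<ge> 2\<close>, some other class takes at least
    \<open>\<tau> * q / 2\<close> of the \<open>q\<close> spheres. The factor
    \<open>1 - \<tau> / 2\<close> obtained here causes the final contradiction.\<close>
  have n_up: "n i \<le> q * (1 - \<tau> / 2)" if i: "i \<in> ?I" for i
  proof -
    obtain j where j: "j \<in> ?I" "j \<noteq> i"
    proof (cases "i = 1")
      case True with m show ?thesis by (intro that[of 2]) auto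
    next
      case False with m show ?thesis by (intro that[of 1]) auto
    qed
    have "(\<Sum>k\<in>{i, j}. n k) \<le> (\<Sum>k\<in>?I. n k)"
      using i j by (intro sum_mono2) (auto simp: n_def)
    then show ?thesis using j n_sum n_low[OF j(1)] by (simp add: algebra_simps)
  qed
  have a_up: "a i \<le> q * (1 - \<tau> / 2) * (q * n i) / 6 + 2 * e i / \<tau>" if i: "i \<in> ?I" for i
  proof -
    let ?deg = "\<lambda>p. card {s \<in> T i. p \<in> s}"
    let ?M = "{p \<in> P. ?deg p = 3}"
    have AP: "A i \<subseteq> P" and TS: "T i \<subseteq> S" using i PA ST by auto
    have npos: "n i > 0" using n_low[OF i] \<tau> q96 by (smt (verit) mult_pos_pos half_gt_zero)
    \<comment> \<open>The whole row sums to the discrepancy of \<open>A i\<close> against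
      \<open>S\<close>. The off-diagonal part is at most \<open>e i\<close>, which leaves at least
      \<open>2 * a i - e i\<close> on the diagonal.\<close>
    have "(\<Sum>j\<in>?I. discrepancy (A i) (T j)) = 2 * a i"
      using discrepancy_UN[OF _ djT, of "A i"] ST disc[OF AP] by (simp add: a_def)
    moreover have "(\<Sum>j\<in>?I. discrepancy (A i) (T j))
        = discrepancy (A i) (T i) + (\<Sum>j\<in>?I - {i}. discrepancy (A i) (T j))"
      using i by (simp add: sum.remove)
    moreover have "(\<Sum>j\<in>?I - {i}. discrepancy (A i) (T j)) \<le> e i"
      unfolding e_def by (intro sum_mono) simp
    ultimately have low: "2 * a i - e i \<le> discrepancy (A i) (T i)" by linarith
    \<comment> \<open>A point of degree at most two in \<open>T i\<close> contributes at most
      \<open>2 - n i / q\<close>; only points of \<open>?M\<close> gain one more. Against the lower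
      bound, the terms \<open>2 * a i\<close> cancel.\<close>
    have "discrepancy (A i) (T i) \<le> (\<Sum>p\<in>A i. (2 - n i / q) + (if p \<in> ?M then 1 else 0))"
      unfolding discrepancy_eq_sum_points
    proof (rule sum_mono)
      fix p assume "p \<in> A i"
      then have "p \<in> P" using AP by auto
      have "?deg p \<le> card {s \<in> S. p \<in> s}" using TS by (intro card_mono) auto
      then have "?deg p \<le> 3" using deg[OF \<open>p \<in> P\<close>] by simp
      then have "?deg p \<le> 2 \<or> ?deg p = 3" by linarith
      then show "real (?deg p) - real (card (T i)) / real CARD('a)
          \<le> (2 - n i / q) + (if p \<in> ?M then 1 else 0)"
        using \<open>p \<in> P\<close> by (auto simp: n_def q_def)
    qed
    also have "\<dots> = (2 - n i / q) * a i + real (card (A i \<inter> ?M))"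
      by (simp add: sum.distrib a_def sum.If_cases mult.commute Int_def)
    also have "real (card (A i \<inter> ?M)) \<le> real (card ?M)" by (simp add: card_mono)
    finally have "n i / q * a i \<le> real (card ?M) + e i" using low by (simp add: algebra_simps)
    moreover have "real (card ?M) \<le> n i ^ 3 / 6"
      using card_points_in_class[OF deg inj TS]
      by (simp add: n_def field_simps flip: of_nat_power of_nat_mult)
    ultimately have "n i / q * a i \<le> n i ^ 3 / 6 + e i" by linarith
    then have "(q / n i) * (n i / q * a i) \<le> (q / n i) * (n i ^ 3 / 6 + e i)"
      using npos q96 by (intro mult_left_mono) auto
    then have "a i \<le> q * n i * n i / 6 + q / n i * e i"
      using npos q96 by (simp add: field_simps power3_eq_cube)
    \<comment> \<open>Only one factor \<open>n i\<close> is estimated; the other is kept linear, so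
      that the bounds can be summed with total class size \<open>q\<close>.\<close>
    moreover have "q * n i * n i \<le> q * n i * (q * (1 - \<tau> / 2))"
      using n_up[OF i] npos q96 by (intro mult_left_mono) auto
    moreover have "q / n i * e i \<le> 2 / \<tau> * e i"
      using n_low[OF i] npos \<tau> by (intro mult_right_mono e_nonneg) (simp add: field_simps)
    moreover have "q * n i * (q * (1 - \<tau> / 2)) = q * (1 - \<tau> / 2) * (q * n i)" by (simp only: mult_ac)
    moreover have "2 / \<tau> * e i = 2 * e i / \<tau>" by simp
    ultimately show ?thesis by linarith
  qed
  have "(1 - \<epsilon>) * N \<le> (\<Sum>i\<in>?I. q * (1 - \<tau> / 2) * (q * n i) / 6 + 2 * e i / \<tau>)"
    using a_sum a_up by (meson order_trans sum_mono)
  also have "\<dots> = q * (1 - \<tau> / 2) * (q * (\<Sum>i\<in>?I. n i)) / 6 + 2 * (\<Sum>i\<in>?I. e i) / \<tau>"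
    by (simp only: sum.distrib sum_distrib_left sum_divide_distrib)
  also have "\<dots> \<le> q * (1 - \<tau> / 2) * (q * q) / 6 + 2 * (2 * \<epsilon> * N) / \<tau>"
    unfolding n_sum using e_sum \<tau> by (intro add_left_mono divide_right_mono mult_left_mono) auto
  also have "\<dots> = q ^ 3 * (1 - \<tau> / 2) / 6 + 4 * \<epsilon> * N / \<tau>" by (simp add: power3_eq_cube mult_ac)
  finally show False
    using block_decomposition_numeric[of N q \<tau> \<epsilon>] N \<tau> q \<epsilon> by simp
qed

section \<open>Ternary quadratic forms\<close>

text \<open>The matrix is not assumed symmetric, so both mixed terms of \<open>Q (x + y)\<close> are
  kept.\<close>

lemma polar_form_expand:
  assumes "\<And>x. Q x = (\<Sum>i\<in>UNIV. \<Sum>j\<in>UNIV. M $ i $ j * x $ i * x $ j)"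
  shows "polar_form Q x y = (\<Sum>i\<in>UNIV. \<Sum>j\<in>UNIV. M $ i $ j * (x $ i * y $ j + y $ i * x $ j))"
  unfolding polar_form_def assms
  by (simp add: algebra_simps flip: sum_subtractf sum.distrib)

lemma
  fixes Q :: "'a::field ^ 'n \<Rightarrow> 'a"
  assumes Q: "quadratic_form Q"
  shows quadratic_form_scale: "Q (s *s x) = s\<^sup>2 * Q x"
    and polar_form_add_left: "polar_form Q (x + y) z = polar_form Q x z + polar_form Q y z"
    and polar_form_scale_left: "polar_form Q (s *s x) z = s * polar_form Q x z"
proof -
  obtain M where M: "\<And>x. Q x = (\<Sum>i\<in>UNIV. \<Sum>j\<in>UNIV. M $ i $ j * x $ i * x $ j)"
    using Q unfolding quadratic_form_def by blast
  show "Q (s *s x) = s\<^sup>2 * Q x"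
    by (simp add: M sum_distrib_left power2_eq_square mult_ac)
  show "polar_form Q (x + y) z = polar_form Q x z + polar_form Q y z"
    by (simp add: polar_form_expand[OF M] algebra_simps flip: sum.distrib)
  show "polar_form Q (s *s x) z = s * polar_form Q x z"
    by (simp add: polar_form_expand[OF M] sum_distrib_left algebra_simps)
qed

lemma polar_form_commute: "polar_form Q x y = polar_form Q y x"
  by (simp add: polar_form_def add.commute)

lemma quadratic_form_add: "Q (x + y) = Q x + Q y + polar_form Q x y"
  by (simp add: polar_form_def)

lemma polar_form_self:
  fixes Q :: "'a::field ^ 'n \<Rightarrow> 'a"
  assumes "quadratic_form Q"
  shows "polar_form Q x x = 2 * Q x"
proof -
  have "x + x = 2 *s x" by (simp add: vec_eq_iff)
  then show ?thesis by (simp add: polar_form_def quadratic_form_scale[OF assms])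
qed

lemma polar_form_add_right:
  fixes Q :: "'a::field ^ 'n \<Rightarrow> 'a"
  assumes "quadratic_form Q"
  shows "polar_form Q z (x + y) = polar_form Q z x + polar_form Q z y"
  using polar_form_add_left[OF assms] polar_form_commute[of Q] by metis

lemma polar_form_scale_right:
  fixes Q :: "'a::field ^ 'n \<Rightarrow> 'a"
  assumes "quadratic_form Q"
  shows "polar_form Q z (s *s x) = s * polar_form Q z x"
  using polar_form_scale_left[OF assms] polar_form_commute[of Q] by metis

lemma polar_form_diff_right:
  fixes Q :: "'a::field ^ 'n \<Rightarrow> 'a"
  assumes "quadratic_form Q"
  shows "polar_form Q z (x - y) = polar_form Q z x - polar_form Q z y"
  using polar_form_add_right[OF assms, of z "x - y" y] by simp

section \<open>Isotropic vectors and hyperbolic pairs\<close>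

text \<open>Pigeonhole: the cube of the field size exceeds its square, so two vectors have the same
  pair of values, and their difference is orthogonal to both. The vectors \<open>u\<close> and
  \<open>w\<close> may be equal.\<close>

lemma exists_orthogonal:
  fixes Q :: "'a::{field,finite} ^ 3 \<Rightarrow> 'a"
  assumes Q: "quadratic_form Q"
  obtains z where "z \<noteq> 0" "polar_form Q u z = 0" "polar_form Q w z = 0"
proof -
  let ?f = "\<lambda>z. (polar_form Q u z, polar_form Q w z)"
  have "\<not> inj ?f"
  proof
    assume "inj ?f"
    then have "card (range ?f) = CARD('a) ^ 3" by (simp add: card_image)
    moreover have "card (range ?f) \<le> card (UNIV :: ('a \<times> 'a) set)" by (rule card_mono) auto
    ultimately have "CARD('a) ^ 3 \<le> CARD('a) ^ 2" by (simp add: power2_eq_square)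
    moreover have "CARD('a) > 1" using card_mono[of UNIV "{0, 1::'a}"] by simp
    ultimately show False using power_strict_increasing[of 2 3 "CARD('a)"] by simp
  qed
  then obtain x y where "x \<noteq> y" "polar_form Q u x = polar_form Q u y" "polar_form Q w x = polar_form Q w y"
    by (auto simp: inj_def)
  then show ?thesis by (intro that[of "x - y"]) (simp_all add: polar_form_diff_right[OF Q])
qed

text \<open>Fibres have at most two elements, and the fibre over \<open>c\<close> only one. The
  resulting strict inequality makes two such ranges meet.\<close>

lemma card_range_quadratic:
  fixes a c :: "'a::{field,finite}"
  assumes a: "a \<noteq> 0"
  shows "CARD('a) < 2 * card (range (\<lambda>x. a * x\<^sup>2 + c))"
proof -
  let ?f = "\<lambda>x. a * x\<^sup>2 + c"
  have fib: "card {x. ?f x = y} \<le> 2" for y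
  proof (cases "\<exists>z. ?f z = y")
    case True
    then obtain z where "?f z = y" by auto
    then have "{x. ?f x = y} = {x. x\<^sup>2 = z\<^sup>2}" using a by auto
    also have "\<dots> = {z, - z}" by (auto simp: power2_eq_iff)
    finally have "card {x. ?f x = y} = card {z, - z}" by simp
    then show ?thesis by (simp add: card_insert_if)
  qed simp
  have "{x. ?f x = c} = {0}" using a by auto
  then have 0: "card {x. ?f x = c} < 2" by simp
  have "c \<in> range ?f" by (rule range_eqI[of _ _ 0]) simp
  have "CARD('a) = (\<Sum>y\<in>range ?f. card {x. ?f x = y})"
    using sum.image_gen[of "UNIV :: 'a set" "\<lambda>_. 1::nat" ?f] by simp
  also have "\<dots> < (\<Sum>y\<in>range ?f. 2)"
  proof (rule sum_strict_mono_ex1)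
    show "\<forall>y\<in>range ?f. card {x. ?f x = y} \<le> 2" using fib by blast
    show "\<exists>y\<in>range ?f. card {x. ?f x = y} < 2" using 0 \<open>c \<in> range ?f\<close> by blast
  qed simp
  finally show ?thesis by simp
qed

text \<open>If \<open>Q\<close> were anisotropic, take pairwise orthogonal \<open>u\<close>,
  \<open>w\<close>, \<open>z\<close>. The values \<open>Q u * x\<^sup>2\<close> and
  \<open>- Q w * y\<^sup>2 - Q z\<close> each fill more than half of the field, so they agree
  somewhere, and \<open>Q\<close> vanishes at \<open>x *s u + y *s w + z\<close>.\<close>

lemma exists_isotropic:
  fixes Q :: "'a::{field,finite} ^ 3 \<Rightarrow> 'a"
  assumes two: "(2::'a) \<noteq> 0" and Q: "quadratic_form Q"
  obtains v where "v \<noteq> 0" "Q v = 0"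
proof -
  have "\<exists>v. v \<noteq> 0 \<and> Q v = 0"
  proof (rule ccontr)
    assume "\<not> (\<exists>v. v \<noteq> 0 \<and> Q v = 0)"
    then have an: "Q v \<noteq> 0" if "v \<noteq> 0" for v using that by blast
    obtain u where u: "u \<noteq> (0 :: 'a ^ 3)" by (metis vec_eq_iff zero_index one_index zero_neq_one)
    obtain w where w: "w \<noteq> 0" "polar_form Q u w = 0" using exists_orthogonal[OF Q, of u u] by blast
    obtain z where z: "z \<noteq> 0" "polar_form Q u z = 0" "polar_form Q w z = 0"
      using exists_orthogonal[OF Q, of u w] by blast
    let ?F = "range (\<lambda>x. Q u * x\<^sup>2 + 0)" and ?G = "range (\<lambda>y. - Q w * y\<^sup>2 + (- Q z))"
    have "?F \<inter> ?G \<noteq> {}"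
    proof
      assume "?F \<inter> ?G = {}"
      then have "card ?F + card ?G = card (?F \<union> ?G)" by (simp add: card_Un_disjoint)
      also have "\<dots> \<le> CARD('a)" by (rule card_mono) auto
      finally show False
        using card_range_quadratic[of "Q u" 0] card_range_quadratic[of "- Q w" "- Q z"] an u w by simp
    qed
    then obtain x y where xy: "Q u * x\<^sup>2 + 0 = - Q w * y\<^sup>2 + (- Q z)" by blast
    let ?v = "x *s u + y *s w + z"
    \<comment> \<open>Pairing with \<open>z\<close> detects that the vector is nonzero.\<close>
    have "polar_form Q ?v z = 2 * Q z"
      by (simp add: polar_form_add_left[OF Q] polar_form_scale_left[OF Q] polar_form_self[OF Q] z)
    then have "polar_form Q ?v z \<noteq> 0" using two an[OF z(1)] by simp
    then have "?v \<noteq> 0" using polar_form_scale_left[OF Q, of 0 0 z] by auto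
    moreover have "Q ?v = x\<^sup>2 * Q u + y\<^sup>2 * Q w + Q z"
      by (simp add: quadratic_form_add[of Q] polar_form_add_left[OF Q] polar_form_scale_left[OF Q]
          polar_form_scale_right[OF Q] quadratic_form_scale[OF Q] z w)
    then have "Q ?v = 0" using xy by (simp add: algebra_simps)
    ultimately show False using an by blast
  qed
  then show ?thesis using that by blast
qed

lemma exists_hyperbolic_pair:
  fixes Q :: "'a::{field,finite} ^ 3 \<Rightarrow> 'a"
  assumes two: "(2::'a) \<noteq> 0" and Q: "quadratic_form Q" and nd: "nondegenerate Q"
  obtains v w where "Q v = 0" "Q w = 0" "polar_form Q v w = 1"
proof -
  obtain v where v: "v \<noteq> 0" "Q v = 0" using exists_isotropic[OF two Q] .
  then obtain y where y: "polar_form Q v y \<noteq> 0" using nd by (auto simp: nondegenerate_def)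
  define z where "z = (1 / polar_form Q v y) *s y"
  have z: "polar_form Q v z = 1" using y by (simp add: z_def polar_form_scale_right[OF Q])
  \<comment> \<open>Adding \<open>s *s v\<close> keeps the pairing with the isotropic
    \<open>v\<close> equal to 1 and raises the value of \<open>Q\<close> by
    \<open>s\<close>.\<close>
  define s where "s = - Q z"
  define w where "w = z + s *s v"
  have "Q w = Q z + s"
    by (simp add: w_def quadratic_form_add[of Q] quadratic_form_scale[OF Q] polar_form_scale_right[OF Q]
        polar_form_commute[of Q z v] z v)
  then have "Q w = 0" by (simp add: s_def)
  moreover have "polar_form Q v w = 1"
    by (simp add: w_def polar_form_add_right[OF Q] polar_form_scale_right[OF Q] polar_form_self[OF Q] v z)
  ultimately show ?thesis using that v(2) by blast
qed

section \<open>Transfer to an arbitrary nondegenerate form\<close>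

text \<open>For a hyperbolic pair \<open>v\<close>, \<open>w\<close> and \<open>n\<close> orthogonal
  to both, the value at \<open>(a * x) *s v + y *s w + z *s n\<close> is
  \<open>a * x * y + Q n * z\<^sup>2\<close>, so \<open>a = Q n\<close> gives the multiple
  \<open>Q n\<close> of \<open>Q0\<close>. Compatibility with differences is what carries spheres to
  spheres.\<close>

lemma similar_to_Q0:
  fixes Q :: "'a::{field,finite} ^ 3 \<Rightarrow> 'a"
  assumes two: "(2::'a) \<noteq> 0" and Q: "quadratic_form Q" and nd: "nondegenerate Q"
  obtains d L where "d \<noteq> 0" "bij L" "\<forall>x y. L (x - y) = L x - L y" "\<forall>x. Q (L x) = d * Q0 x"
proof -
  obtain v w where vw: "Q v = 0" "Q w = 0" "polar_form Q v w = 1"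
    using exists_hyperbolic_pair[OF two Q nd] .
  obtain n where n: "n \<noteq> 0" "polar_form Q v n = 0" "polar_form Q w n = 0"
    using exists_orthogonal[OF Q] .
  note B = polar_form_add_left[OF Q] polar_form_scale_left[OF Q] polar_form_add_right[OF Q]
    polar_form_scale_right[OF Q] polar_form_self[OF Q] polar_form_commute[of Q w v]
    polar_form_commute[of Q n v] polar_form_commute[of Q n w]
  have B0: "polar_form Q 0 x = 0" for x using polar_form_scale_left[OF Q, of 0 0 x] by simp
  \<comment> \<open>The scale \<open>a\<close> stays free: \<open>G 1\<close> serves to show
    \<open>Q n \<noteq> 0\<close>, and only then can \<open>Q n\<close> be used as the
    scale.\<close>
  define G where "G a p = (a * p $ 1) *s v + p $ 2 *s w + p $ 3 *s n" for a and p :: "'a ^ 3"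
  have G_diff: "G a (x - y) = G a x - G a y" for a x y
    by (simp add: G_def vec_eq_iff algebra_simps)
  have bij_G: "bij (G a)" if a: "a \<noteq> 0" for a
  proof -
    \<comment> \<open>Pairing with \<open>w\<close> and \<open>v\<close> isolates the first two
      coordinates; the third is then left with \<open>n \<noteq> 0\<close>.\<close>
    have "p = 0" if p: "G a p = 0" for p
    proof -
      have "polar_form Q (G a p) w = a * p $ 1" "polar_form Q (G a p) v = p $ 2"
        by (simp_all add: G_def B vw n)
      then have 12: "p $ 1 = 0" "p $ 2 = 0" using p a B0 by auto
      then have "p $ 3 *s n = 0" using p by (simp add: G_def)
      then have "p $ 3 = 0" using n(1) by simp
      with 12 show "p = 0" by (simp add: vec_eq_iff forall_3)
    qed
    then have "inj (G a)" by (metis G_diff injI eq_iff_diff_eq_0)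
    then show ?thesis by (simp add: bij_def finite_UNIV_inj_surj)
  qed
  \<comment> \<open>Otherwise \<open>n\<close> would be orthogonal to \<open>v\<close>,
    \<open>w\<close> and itself, which span the space, against nondegeneracy.\<close>
  have "Q n \<noteq> 0"
  proof
    assume Qn: "Q n = 0"
    have "polar_form Q n y = 0" for y
    proof -
      obtain p where "y = G 1 p" using bij_G[of 1] by (auto simp: bij_def elim: surjE)
      then show ?thesis by (simp add: G_def B n Qn)
    qed
    then show False using nd n(1) by (auto simp: nondegenerate_def)
  qed
  moreover have "Q (G (Q n) x) = Q n * Q0 x" for x
    by (simp add: G_def Q0_def quadratic_form_add[of Q] quadratic_form_scale[OF Q] B vw n algebra_simps)
  ultimately show ?thesis using that[of "Q n" "G (Q n)"] bij_G G_diff by blast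
qed

text \<open>The similarity carries the sphere with centre \<open>tc_center t\<close> and radius
  \<open>R\<close> onto the \<open>Q\<close>-sphere with centre \<open>L (tc_center t)\<close> and
  radius \<open>d * R\<close>, which is nonzero; as a bijection it preserves incidences.\<close>

lemma isomorphic_example:
  fixes Q :: "'a::{field,finite} ^ 3 \<Rightarrow> 'a" and R :: 'a
  assumes two: "(2::'a) \<noteq> 0" and Q: "quadratic_form Q" and nd: "nondegenerate Q" and R: "R \<noteq> 0"
  shows "\<exists>r P' S'. r \<noteq> 0 \<and> (\<forall>S\<in>S'. \<exists>c. S = qsphere Q c r) \<and>
    (\<exists>f g. inc_iso f g (sphere_system (P_tc R) (S_tc R)) (sphere_system P' S'))"
proof -
  obtain d L where d: "d \<noteq> 0" and L: "bij L" and "\<forall>x y. L (x - y) = L x - L y"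
    and "\<forall>x. Q (L x) = d * Q0 x"
    using similar_to_Q0[OF two Q nd] .
  then have L_diff: "L (x - y) = L x - L y" and QL: "Q (L x) = d * Q0 x" for x y
    by simp_all
  have inj: "inj L" using L by (rule bij_is_inj)
  have img: "L ` tc_sphere R t = qsphere Q (L (tc_center t)) (d * R)" for t
  proof (intro equalityI subsetI)
    fix y assume "y \<in> L ` tc_sphere R t"
    then show "y \<in> qsphere Q (L (tc_center t)) (d * R)"
      by (auto simp: tc_sphere_def qsphere_def QL simp flip: L_diff)
  next
    fix y assume y: "y \<in> qsphere Q (L (tc_center t)) (d * R)"
    obtain x where "y = L x" using L by (auto simp: bij_def elim: surjE)
    with y show "y \<in> L ` tc_sphere R t"
      using d by (auto simp: tc_sphere_def qsphere_def QL simp flip: L_diff)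
  qed
  have "inc_iso L ((`) L) (sphere_system (P_tc R) (S_tc R)) (sphere_system (L ` P_tc R) ((`) L ` S_tc R))"
    by (auto simp: inc_iso_def sphere_system_def inj_image_eq_iff[OF inj] inj_image_mem_iff[OF inj]
        intro!: inj_on_imp_bij_betw inj_onI injD[OF inj])
  moreover have "\<exists>c. S = qsphere Q c (d * R)" if "S \<in> (`) L ` S_tc R" for S
    using that img by (auto simp: S_tc_eq)
  ultimately show ?thesis using d R by (intro exI[of _ "d * R"]) auto
qed

section \<open>The normalising constant\<close>

lemma tc_K_tendsto: "tc_K \<longlonglongrightarrow> sqrt (2 / 3)"
proof -
  have "(\<lambda>q. 2 * sqrt ((real q - 1)\<^sup>2 * (real q - 2) / 6) / real q powr (3 / 2)) \<longlonglongrightarrow> 2 * (1 / 6) powr (1 / 2)"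
    by real_asymp
  \<comment> \<open>The factor 2 enters the root as 4.\<close>
  also have "2 * (1 / 6) powr (1 / 2) = sqrt (2 / 3 :: real)"
    using real_sqrt_mult[of 4 "1 / 6"] by (simp add: powr_half_sqrt)
  finally show ?thesis by (simp add: tc_K_def[abs_def])
qed

lemma tc_K_squared:
  assumes "q \<ge> 2"
  shows "(tc_K q)\<^sup>2 * real q ^ 3 = 4 * ((real q - 1)\<^sup>2 * (real q - 2) / 6)"
proof -
  have "(real q powr (3 / 2))\<^sup>2 = real q powr (2 * (3 / 2))"
    by (simp add: power2_eq_square flip: powr_add)
  also have "\<dots> = real q ^ 3" using assms by (simp flip: powr_numeral)
  finally show ?thesis
    using assms by (simp add: tc_K_def power_divide power_mult_distrib)
qed

text \<open>The lower bound yields the upper end of the window, \<open>q \<le> 2 * K * q\<close>;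
  the upper bound yields the richness of all pairs.\<close>

lemma tc_K_bounds:
  assumes "q \<ge> 5"
  shows "1 / 2 \<le> tc_K q" "tc_K q \<le> 1"
proof -
  \<comment> \<open>In terms of \<open>k = q - 5\<close>, the differences of both sides after
    squaring are polynomials with nonnegative coefficients.\<close>
  obtain k where k: "q = 5 + k" using assms le_Suc_ex by blast
  have nonneg: "tc_K q \<ge> 0" using assms by (simp add: tc_K_def)
  have sq: "(tc_K q)\<^sup>2 * real q ^ 3 = 4 * ((real q - 1)\<^sup>2 * (real q - 2) / 6)"
    using tc_K_squared assms by simp
  have "(tc_K q)\<^sup>2 * real q ^ 3 = (1 / 2)\<^sup>2 * real q ^ 3
      + (3 / 4 + 95 / 12 * real k + 43 / 12 * real k ^ 2 + 5 / 12 * real k ^ 3)"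
    unfolding sq unfolding k by (simp add: power2_eq_square power3_eq_cube algebra_simps)
  then have "(1 / 2)\<^sup>2 * real q ^ 3 \<le> (tc_K q)\<^sup>2 * real q ^ 3" by simp
  then have "(1 / 2)\<^sup>2 \<le> (tc_K q)\<^sup>2"
    using assms by (simp add: mult_le_cancel_right)
  then show "1 / 2 \<le> tc_K q" using nonneg by (rule power2_le_imp_le)
  have "(tc_K q)\<^sup>2 * real q ^ 3 \<le> 1\<^sup>2 * real q ^ 3"
    unfolding sq unfolding k by (simp add: power2_eq_square power3_eq_cube algebra_simps)
  then have "(tc_K q)\<^sup>2 \<le> 1\<^sup>2"
    using assms by (simp add: mult_le_cancel_right)
  then show "tc_K q \<le> 1" by (rule power2_le_imp_le) simp
qed

text \<open>\<open>K\<close> is given by its defining equation and then identified with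
  \<open>tc_K q\<close>, which depends on the field size alone, so that the limit makes
  sense.\<close>

theorem theorem4p14:
  fixes R :: "'a::{field,finite}" and q N :: nat and \<Sigma> K :: real
  assumes char: "CHAR('a) \<noteq> 2" "CHAR('a) \<noteq> 3"
    and q: "q = CARD('a)" "q \<ge> 5"
    and R: "R \<noteq> 0"
    and N: "N = card (P_tc R)"
    and Sigma: "\<Sigma> = discrepancy (P_tc R) (S_tc R)"
    and K: "\<Sigma> = K * real q * sqrt (real (card (P_tc R)) * real (card (S_tc R)))"
  shows
    "((\<forall>S\<in>S_tc R. \<exists>c. S = qsphere Q0 c R)
     \<and> inj (\<lambda>t. sphere_lift Q0 (tc_center t) R)
     \<and> (\<forall>L. affine_line L \<longrightarrow> card (L \<inter> range (\<lambda>t. sphere_lift Q0 (tc_center t) R)) < 3)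
     \<and> (\<forall>C. coaxal_pencil Q0 C \<longrightarrow> card (C \<inter> S_tc R) < 3))
     \<and>
     (real N = (real q - 1)\<^sup>2 * (real q - 2) / 6
     \<and> (\<forall>A\<in>triples. \<forall>t. tc_point R A \<in> tc_sphere R t \<longleftrightarrow> t \<in> A)
     \<and> (\<forall>p\<in>P_tc R. card {S \<in> S_tc R. p \<in> S} = 3)
     \<and> incidences (P_tc R) (S_tc R) = 3 * N
     \<and> \<Sigma> = 2 * real N
     \<and> K = 2 * sqrt (real N) / real q powr (3 / 2)
     \<and> K = tc_K q \<and> tc_K \<longlonglongrightarrow> sqrt (2 / 3)
     \<and> K\<^sup>2 * (real q)\<^sup>2 * real (card (S_tc R)) = 4 * real (card (P_tc R)))
     \<and>
     ((\<forall>a b. a \<noteq> b \<longrightarrow>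
        q - 3 \<le> card (P_tc R \<inter> tc_sphere R a \<inter> tc_sphere R b) \<and>
        card (P_tc R \<inter> tc_sphere R a \<inter> tc_sphere R b) \<le> q - 2)
     \<and> 4 * real (card (P_tc R)) / (K\<^sup>2 * (real q)\<^sup>2) \<le> real (card (S_tc R))
     \<and> real (card (S_tc R)) \<le> 2 * K * real q
     \<and> (\<forall>S\<in>S_tc R. \<forall>S'\<in>S_tc R. S \<noteq> S' \<longrightarrow>
          real (card (P_tc R \<inter> S \<inter> S')) \<ge> K * real q / (4 * 2)))
     \<and>
     ((\<forall>B\<subseteq>P_tc R. discrepancy B (S_tc R) = 2 * real (card B))
     \<and> (\<forall>a b. a \<noteq> b \<longrightarrow>
          discrepancy (P_tc R \<inter> tc_sphere R a \<inter> tc_sphere R b) (S_tc R) / \<Sigma>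
            \<le> 6 / (real q - 1)\<^sup>2))
     \<and>
     (inc_iso (tc_point R) (tc_sphere R) D30 (sphere_system (P_tc R) (S_tc R))
     \<and> (\<forall>\<tau> \<epsilon>. 0 < \<tau> \<longrightarrow> \<tau> \<le> 1 \<longrightarrow> real q \<ge> 96 / \<tau> \<longrightarrow> 0 \<le> \<epsilon> \<longrightarrow> \<epsilon> \<le> \<tau>\<^sup>2 / 144 \<longrightarrow>
          \<not> (\<exists>m A R' T. centered_block_decomposition \<tau> \<epsilon> (P_tc R) (S_tc R) m A R' T)))
     \<and>
     (\<forall>Q :: 'a ^ 3 \<Rightarrow> 'a. quadratic_form Q \<longrightarrow> nondegenerate Q \<longrightarrow>
       (\<exists>r P' S'. r \<noteq> 0 \<and> (\<forall>S\<in>S'. \<exists>c. S = qsphere Q c r) \<and>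
          (\<exists>f g. inc_iso f g (sphere_system (P_tc R) (S_tc R)) (sphere_system P' S'))))"
proof -
  have two: "(2::'a) \<noteq> 0" and three: "(3::'a) \<noteq> 0"
    using CHAR_neq_imp_two_neq_0 CHAR_neq_imp_three_neq_0 char by blast+
  have cS: "card (S_tc R) = q" using card_S_tc[OF two] q by simp
  have Nq: "real N = (real q - 1)\<^sup>2 * (real q - 2) / 6"
    using card_P_tc[OF two three, of R] N q by simp
  have "(real q - 1)\<^sup>2 * (real q - 2) > 0" using q(2) by simp
  then have Npos: "real N > 0" using Nq by simp
  have deg: "\<And>p. p \<in> P_tc R \<Longrightarrow> card {S \<in> S_tc R. p \<in> S} = 3"
    by (rule degree_P_tc[OF two])
  have disc: "discrepancy B (S_tc R) = 2 * real (card B)" if "B \<subseteq> P_tc R" for B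
    using discrepancy_regular[OF card_S_tc[OF two] deg that] .
  have SN: "\<Sigma> = 2 * real N" using disc[of "P_tc R"] Sigma N by simp
  have "real (incidences (P_tc R) (S_tc R)) = 3 * real N"
    using SN Sigma cS q(2) N unfolding discrepancy_def q(1)[symmetric] by simp
  then have inc: "incidences (P_tc R) (S_tc R) = 3 * N" by linarith
  have q32: "real q powr (3 / 2) = real q * sqrt (real q)"
  proof -
    have "real q powr (3 / 2) = real q powr (1 + 1 / 2)" by simp
    also have "\<dots> = real q * sqrt (real q)" by (simp only: powr_add powr_half_sqrt) simp
    finally show ?thesis .
  qed
  have KN: "K = 2 * sqrt (real N) / real q powr (3 / 2)"
  proof -
    \<comment> \<open>The defining equation reads \<open>2 * N = K * q * sqrt (N * q)\<close>; one
      factor \<open>sqrt N\<close> cancels because \<open>N\<close> is positive.\<close>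
    have "2 * (sqrt (real N) * sqrt (real N)) = K * real q * (sqrt (real N) * sqrt (real q))"
      using K SN cS N by (simp add: real_sqrt_mult)
    then have "sqrt (real N) * (2 * sqrt (real N)) = sqrt (real N) * (K * (real q * sqrt (real q)))"
      by (simp only: mult_ac)
    then have "2 * sqrt (real N) = K * (real q * sqrt (real q))"
      by (rule mult_left_cancel[THEN iffD1, rotated]) (use Npos in simp)
    then show ?thesis using q(2) unfolding q32 by (simp add: field_simps)
  qed
  then have KK: "K = tc_K q" by (simp add: tc_K_def Nq)
  have K2: "K\<^sup>2 * (real q)\<^sup>2 * real q = 4 * real N"
    using tc_K_squared[of q] q(2) unfolding KK Nq by (simp add: power2_eq_square power3_eq_cube mult_ac)
  have Kb: "1 / 2 \<le> K" "K \<le> 1" using tc_K_bounds[OF q(2)] KK by simp_all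
  have pair: "q - 3 \<le> card (P_tc R \<inter> tc_sphere R a \<inter> tc_sphere R b)"
    "card (P_tc R \<inter> tc_sphere R a \<inter> tc_sphere R b) \<le> q - 2" if "a \<noteq> b" for a b
    using card_P_tc_Int_two_spheres[OF two that] q by simp_all
  have radius: "\<exists>c. S = qsphere Q0 c R" if "S \<in> S_tc R" for S
    using that by (auto simp: S_tc_eq tc_sphere_def)
  have KS: "K\<^sup>2 * (real q)\<^sup>2 * real (card (S_tc R)) = 4 * real (card (P_tc R))"
    using K2 cS N by simp
  \<comment> \<open>By \<open>K2\<close> the lower end of the window is attained with
    equality.\<close>
  have window: "4 * real (card (P_tc R)) / (K\<^sup>2 * (real q)\<^sup>2) \<le> real (card (S_tc R))"
  proof -
    have "K\<^sup>2 * (real q)\<^sup>2 > 0" using Kb q(2) by simp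
    then show ?thesis using K2 cS N by (simp add: divide_le_eq mult_ac)
  qed
  have small: "real (card (S_tc R)) \<le> 2 * K * real q"
    using mult_right_mono[of 1 "2 * K" "real q"] Kb cS by simp
  have rich: "real (card (P_tc R \<inter> S \<inter> S')) \<ge> K * real q / (4 * 2)"
    if S: "S \<in> S_tc R" "S' \<in> S_tc R" "S \<noteq> S'" for S S'
  proof -
    obtain a b where ab: "S = tc_sphere R a" "S' = tc_sphere R b" "a \<noteq> b"
      using S by (auto simp: S_tc_eq)
    \<comment> \<open>The threshold is at most \<open>q / 8\<close>, which is below
      \<open>q - 3\<close> for \<open>q \<ge> 5\<close>.\<close>
    have "real q - 3 \<le> real (card (P_tc R \<inter> S \<inter> S'))" using pair(1)[OF ab(3)] unfolding ab(1,2) by linarith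
    moreover have "K * real q \<le> 1 * real q" using Kb by (intro mult_right_mono) auto
    moreover have "real q \<ge> 5" using q(2) by simp
    ultimately show ?thesis by linarith
  qed
  have ratio: "discrepancy (P_tc R \<inter> tc_sphere R a \<inter> tc_sphere R b) (S_tc R) / \<Sigma> \<le> 6 / (real q - 1)\<^sup>2"
    if "a \<noteq> b" for a b
  proof -
    have "real (card (P_tc R \<inter> tc_sphere R a \<inter> tc_sphere R b)) \<le> real q - 2"
      using pair(2)[OF that] q(2) by linarith
    moreover have "discrepancy (P_tc R \<inter> tc_sphere R a \<inter> tc_sphere R b) (S_tc R)
        = 2 * real (card (P_tc R \<inter> tc_sphere R a \<inter> tc_sphere R b))"
      by (rule disc) auto
    ultimately have "discrepancy (P_tc R \<inter> tc_sphere R a \<inter> tc_sphere R b) (S_tc R) / \<Sigma>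
        \<le> 2 * (real q - 2) / (2 * real N)"
      unfolding SN using Npos by (intro divide_right_mono) auto
    also have "\<dots> = 6 / (real q - 1)\<^sup>2"
      unfolding Nq using q(2) by (simp add: field_simps)
    finally show ?thesis .
  qed
  have nodec: "\<not> (\<exists>m A R' T. centered_block_decomposition \<tau> \<epsilon> (P_tc R) (S_tc R) m A R' T)"
    if "0 < \<tau>" "\<tau> \<le> 1" "real q \<ge> 96 / \<tau>" "0 \<le> \<epsilon>" "\<epsilon> \<le> \<tau>\<^sup>2 / 144" for \<tau> \<epsilon>
    using no_centered_block_decomposition[of "S_tc R" "P_tc R" \<tau> \<epsilon>] that deg
      inj_on_spheres_through[OF two] card_S_tc[OF two] card_P_tc_Int_sphere[OF two]
      card_P_tc[OF two three] q(1) by simp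
  show ?thesis
    by (intro conjI allI ballI impI radius inj_tc_lift[OF two] card_line_Int_tc_lifts[OF two]
        card_coaxal_pencil_Int_S_tc[OF two] Nq tc_point_mem_tc_sphere_iff[OF two] deg inc SN KN KK
        tc_K_tendsto KS pair window small rich disc ratio inc_iso_D30[OF two] nodec
        isomorphic_example[OF two _ _ R]; assumption)
qed

end
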